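(* For every integer $m\ge 1$, $\mathrm{Free}^\infty(\mathbb{T}^m,\mathbb{R}^{q_m})\neq\emptyset$, where $q_m=m(m+3)/2$; that is, there exists a $C^\infty$ free map $\mathbb{T}^m\to\mathbb{R}^{m(m+3)/2}$.
   Context: $\mathbb{T}^m=\mathbb{R}^m/2\pi\mathbb{Z}^m$ with its flat coordinates, and $q_m=m(m+3)/2$. A $C^2$ map $f:\mathbb{T}^m\to\mathbb{R}^q$ is free if the $q_m$ vectors $\partial_\alpha f$ ($1\le\alpha\le m$) and $\partial_\alpha\partial_\beta f$ ($1\le\alpha\le\beta\le m$) in $\mathbb{R}^q$ are linearly independent at every point of $\mathbb{T}^m$. $\mathrm{Free}^\infty(\mathbb{T}^m,\mathbb{R}^q)$ denotes the set of $C^\infty$ free maps $\mathbb{T}^m\to\mathbb{R}^q$. *)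

theory Defs
  imports "HOL-Analysis.Analysis"
begin

text \<open>
  \<open>CARD('m)\<close> plays the role of the dimension \<open>m\<close>, and \<open>'m\<close> that of the ordered index set
  \<open>{1, ..., m}\<close>.
\<close>

definition torus_rel :: "real^'m \<Rightarrow> real^'m \<Rightarrow> bool" where
  "torus_rel x y \<longleftrightarrow> (\<forall>i. \<exists>k::int. x $ i - y $ i = 2 * pi * of_int k)"

lemma equivp_torus_rel: "equivp torus_rel"
proof (rule equivpI)
  show "reflp torus_rel"
    by (auto simp: reflp_def torus_rel_def intro: exI[of _ 0])
  show "symp torus_rel"
  proof (rule sympI)
    fix x y :: "real^'m"
    assume xy: "torus_rel x y"
    show "torus_rel y x"
      unfolding torus_rel_def
    proof
      fix i
      obtain k :: int where "x $ i - y $ i = 2 * pi * of_int k"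
        using xy unfolding torus_rel_def by blast
      then have "y $ i - x $ i = 2 * pi * of_int (- k)"
        by simp
      then show "\<exists>k::int. y $ i - x $ i = 2 * pi * of_int k" ..
    qed
  qed
  show "transp torus_rel"
  proof (rule transpI)
    fix x y z :: "real^'m"
    assume xy: "torus_rel x y" and yz: "torus_rel y z"
    show "torus_rel x z"
      unfolding torus_rel_def
    proof
      fix i
      obtain k l :: int where "x $ i - y $ i = 2 * pi * of_int k" "y $ i - z $ i = 2 * pi * of_int l"
        using xy yz unfolding torus_rel_def by blast
      then have "x $ i - z $ i = 2 * pi * of_int (k + l)"
        by (simp add: algebra_simps)
      then show "\<exists>k::int. x $ i - z $ i = 2 * pi * of_int k" ..
    qed
  qed
qed

quotient_type 'm torus = "real^'m" / torus_rel
  morphisms rep_torus torus_proj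
  by (rule equivp_torus_rel)

text \<open>
  Differentiability on the torus is understood in the flat coordinates, that is, through the
  \<open>2\<pi>\<close>-periodic lift to the universal cover.
\<close>

definition torus_lift :: "('m::finite torus \<Rightarrow> 'b) \<Rightarrow> real^'m \<Rightarrow> 'b" where
  "torus_lift f = (\<lambda>x. f (torus_proj x))"

definition partial :: "'m \<Rightarrow> (real^'m \<Rightarrow> 'b::real_normed_vector) \<Rightarrow> real^'m \<Rightarrow> 'b" where
  "partial \<alpha> F = (\<lambda>x. frechet_derivative F (at x) (axis \<alpha> 1))"

text \<open>\<open>frechet_derivative\<close> is unspecified where \<open>F\<close> is not differentiable, hence the
  differentiability requirement below.\<close>

fun C_times :: "nat \<Rightarrow> (real^'m \<Rightarrow> 'b::real_normed_vector) \<Rightarrow> bool" where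
  "C_times 0 F \<longleftrightarrow> continuous_on UNIV F"
| "C_times (Suc k) F \<longleftrightarrow> (\<forall>x. F differentiable (at x)) \<and> (\<forall>\<alpha>. C_times k (partial \<alpha> F))"

definition torus_C :: "nat \<Rightarrow> ('m::finite torus \<Rightarrow> 'b::real_normed_vector) \<Rightarrow> bool" where
  "torus_C k f \<longleftrightarrow> C_times k (torus_lift f)"

definition torus_smooth :: "('m::finite torus \<Rightarrow> 'b::real_normed_vector) \<Rightarrow> bool" where
  "torus_smooth f \<longleftrightarrow> (\<forall>k. torus_C k f)"

definition jet_index :: "('m::{finite,linorder} + 'm \<times> 'm) set" where
  "jet_index = range Inl \<union> Inr ` {(\<alpha>, \<beta>). \<alpha> \<le> \<beta>}"

fun jet :: "(real^'m \<Rightarrow> 'b::real_normed_vector) \<Rightarrow> real^'m \<Rightarrow> 'm + 'm \<times> 'm \<Rightarrow> 'b" where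
  "jet F x (Inl \<alpha>) = partial \<alpha> F x"
| "jet F x (Inr (\<alpha>, \<beta>)) = partial \<alpha> (partial \<beta> F) x"

text \<open>
  \<open>independent\<close> is a predicate on sets; injectivity turns it into linear independence of the
  indexed family.
\<close>

definition free_map :: "('m::{finite,linorder} torus \<Rightarrow> 'b::real_normed_vector) \<Rightarrow> bool" where
  "free_map f \<longleftrightarrow> torus_C 2 f \<and>
     (\<forall>x. inj_on (jet (torus_lift f) x) jet_index \<and>
          independent (jet (torus_lift f) x ` jet_index))"

definition Free_smooth :: "('m::{finite,linorder} torus \<Rightarrow> real^'q) set" where
  "Free_smooth = {f. torus_smooth f \<and> free_map f}"

definition q_dim :: "nat \<Rightarrow> nat" where
  "q_dim m = m * (m + 3) div 2"

end

theory Submission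
  imports Defs
begin

text \<open>
  A map is free at a point if and only if no nonzero operator
  \<open>D = \<Sum> l\<^sub>i \<partial>\<^sub>i + \<Sum> Q\<^sub>i\<^sub>j \<partial>\<^sub>i\<partial>\<^sub>j\<close> with symmetric \<open>Q\<close> annihilates all its components there.
  These operators form a space of dimension \<open>m (m + 3) / 2\<close>, so in the critical dimension there
  are exactly as many components as operators. A suitable family of trigonometric polynomials is
  built by adding one circle factor at a time, starting from \<open>(cos t, sin t)\<close>.

  Let \<open>f\<close> be such a family on the \<open>m\<close>-torus, and let \<open>t\<close> be a new coordinate. There are \<open>m + 2\<close> new
  operators \<open>\<partial>\<^sub>t\<close>, \<open>\<partial>\<^sub>t\<partial>\<^sub>t\<close>, \<open>\<partial>\<^sub>i\<partial>\<^sub>t\<close>, hence room for \<open>m + 2\<close> new functions \<open>h\<close>. It is not possible to keep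
  \<open>f\<close>: then \<open>\<partial>\<^sub>t h\<close> together with its first derivatives would have to be linearly independent, and
  normalizing it would immerse the \<open>(m + 1)\<close>-torus into the \<open>(m + 1)\<close>-sphere, thus cover a simply
  connected space if \<open>m \<ge> 1\<close>. Instead two components
  of \<open>f\<close> are translated by a rapidly oscillating curve. With a large integer \<open>n\<close>, the new family is

  \<^item> \<open>f\<^sub>0(nx) + cos t cos nt\<close>, \<open>f\<^sub>1(nx) + sin t cos nt\<close>, and \<open>f\<^sub>a(nx)\<close> for \<open>a \<ge> 2\<close>;

  \<^item> \<open>h = - f\<^sub>0(nx) W\<^sub>0(x) - f\<^sub>1(nx) W\<^sub>1(x) + \<eta>(x, t) / n + sin nt e(t)\<close> with values in \<open>\<real>\<^bsup>m+2\<^esup>\<close>.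

  Let \<open>D\<close> annihilate this family at \<open>(x, t)\<close>, and let \<open>p\<close> and \<open>q\<close> be the values of \<open>D\<close> on \<open>cos nt\<close>
  and \<open>sin nt\<close>. The first group of components shows that \<open>D\<close> maps \<open>(f\<^sub>0, f\<^sub>1)(nx)\<close> to about
  \<open>- p (cos t, sin t)\<close>. As \<open>W\<^sub>0\<close>, \<open>W\<^sub>1\<close> vary slowly compared with \<open>f(nx)\<close>, they pass through \<open>D\<close> like
  constants, up to errors of order \<open>1/n\<close>. Therefore \<open>D h = 0\<close> says, up to such errors,

    \<open>p (cos t W\<^sub>0 + sin t W\<^sub>1) + q e(t) + \<Sum> c\<^sub>i \<partial>\<^sub>i\<partial>\<^sub>t\<eta> = 0\<close> where \<open>c\<^sub>i = 2 Q\<^sub>i\<^sub>t / n\<close>.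

  The point is that the transversal direction \<open>cos t W\<^sub>0 + sin t W\<^sub>1\<close> can be rotated at will. Let
  \<open>u\<close> immerse the \<open>m\<close>-torus into \<open>\<real>\<^bsup>m+1\<^esup>\<close> with a transversal field \<open>\<nu>\<close>. Identify \<open>\<real>\<^bsup>k\<^esup>\<close> with the polynomials
  of degree less than \<open>k\<close>, and let \<open>A(t)\<close> be multiplication by \<open>cos t + X sin t\<close>, an injective map
  from \<open>\<real>\<^bsup>m+1\<^esup>\<close> to \<open>\<real>\<^bsup>m+2\<^esup>\<close>. Since \<open>A\<close> has mean zero, \<open>A(t) u\<close> is \<open>\<partial>\<^sub>t\<eta>\<close> for some periodic \<open>\<eta>\<close>; and if \<open>W\<^sub>0\<close>
  and \<open>W\<^sub>1\<close> are \<open>\<nu>\<close> and \<open>X \<nu>\<close>, then \<open>cos t W\<^sub>0 + sin t W\<^sub>1 = A(t) \<nu>\<close>. So the displayed vectors are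
  \<open>A(t) \<nu>\<close>, \<open>e(t)\<close> and \<open>A(t) \<partial>\<^sub>i u\<close>, which are independent when \<open>e(t)\<close> is chosen outside the image of
  \<open>A(t)\<close>. By compactness they are uniformly independent, which absorbs the errors for large \<open>n\<close> and
  forces \<open>D = 0\<close>.

  The geometric input is \<open>torus_hypersurface\<close> and \<open>rotating_shift_injective\<close>, combined in
  \<open>moving_frame\<close>; the asymptotics are \<open>fast_slow_asymptotics\<close> and its companions; the induction step
  is \<open>nondegenerate_insert\<close>.
\<close>

section \<open>Partial derivatives\<close>

lemma partial_eqI: "(F has_derivative F') (at x) \<Longrightarrow> partial \<alpha> F x = F' (axis \<alpha> 1)"
  unfolding partial_def using frechet_derivative_at by metis

lemma partial_const [simp]: "partial \<alpha> (\<lambda>x. c) = (\<lambda>x. 0)"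
  by (rule ext, rule partial_eqI[where F' = "\<lambda>_. 0"]) auto

lemma partial_add:
  "F differentiable (at x) \<Longrightarrow> G differentiable (at x) \<Longrightarrow>
    partial \<alpha> (\<lambda>x. F x + G x) x = partial \<alpha> F x + partial \<alpha> G x"
  unfolding frechet_derivative_works
  by (subst partial_eqI, rule has_derivative_add, assumption, assumption) (simp add: partial_def)

lemma partial_mult:
  fixes F G :: "real^'m::finite \<Rightarrow> real"
  assumes "F differentiable (at x)" "G differentiable (at x)"
  shows "partial \<alpha> (\<lambda>x. F x * G x) x = F x * partial \<alpha> G x + G x * partial \<alpha> F x"
proof -
  note d = assms[unfolded frechet_derivative_works]
  show ?thesis
    by (subst partial_eqI[OF has_derivative_mult[OF d]]) (simp add: partial_def)
qed

lemma partial_coord: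
  fixes x :: "real^'m::finite"
  assumes "(g has_real_derivative g') (at (x $ i))"
  shows "partial \<alpha> (\<lambda>x. g (x $ i)) x = (if \<alpha> = i then g' else 0)"
proof -
  have "((\<lambda>x. g (x $ i)) has_derivative (\<lambda>h. h $ i * g')) (at x)"
    using assms by (rule DERIV_compose_FDERIV)
      (rule bounded_linear_imp_has_derivative, rule bounded_linear_vec_nth)
  from partial_eqI[OF this] show ?thesis
    by (auto simp: axis_def)
qed

lemma partial_dilate:
  fixes F :: "real^'m::finite \<Rightarrow> real"
  assumes "F differentiable (at (K *\<^sub>R x))"
  shows "partial \<alpha> (\<lambda>x. F (K *\<^sub>R x)) x = K * partial \<alpha> F (K *\<^sub>R x)"
proof -
  have d: "(F has_derivative frechet_derivative F (at (K *\<^sub>R x))) (at (K *\<^sub>R x))"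
    using assms by (simp add: frechet_derivative_works)
  have "((\<lambda>x. K *\<^sub>R x) has_derivative (\<lambda>h. K *\<^sub>R h)) (at x)"
    by (intro bounded_linear_imp_has_derivative bounded_linear_scaleR_right)
  then have "((\<lambda>x. F (K *\<^sub>R x)) has_derivative (\<lambda>h. frechet_derivative F (at (K *\<^sub>R x)) (K *\<^sub>R h))) (at x)"
    using has_derivative_compose d by blast
  moreover have "linear (frechet_derivative F (at (K *\<^sub>R x)))"
    using d has_derivative_linear by blast
  ultimately show ?thesis
    by (subst partial_eqI) (auto simp: partial_def linear_cmul)
qed

section \<open>Trigonometric polynomials\<close>

text \<open>
  The set \<open>S\<close> records the coordinates on which a function may depend. Everything below stays in this
  algebra, so smoothness, periodicity and boundedness come for free, and functions on a torus of
  lower dimension need not be carried by a type of their own.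
\<close>
inductive trig_poly :: "'m set \<Rightarrow> (real^'m::finite \<Rightarrow> real) \<Rightarrow> bool" for S where
  const: "trig_poly S (\<lambda>x. c)"
| cos: "i \<in> S \<Longrightarrow> trig_poly S (\<lambda>x. cos (x $ i))"
| sin: "i \<in> S \<Longrightarrow> trig_poly S (\<lambda>x. sin (x $ i))"
| add: "trig_poly S F \<Longrightarrow> trig_poly S G \<Longrightarrow> trig_poly S (\<lambda>x. F x + G x)"
| mult: "trig_poly S F \<Longrightarrow> trig_poly S G \<Longrightarrow> trig_poly S (\<lambda>x. F x * G x)"

lemma trig_poly_mono: "trig_poly S F \<Longrightarrow> S \<subseteq> T \<Longrightarrow> trig_poly T F"
  by (induction rule: trig_poly.induct) (auto intro: trig_poly.intros)

lemma trig_poly_minus: "trig_poly S F \<Longrightarrow> trig_poly S (\<lambda>x. - F x)"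
  using trig_poly.mult[OF trig_poly.const[of S "-1"]] by fastforce

lemma trig_poly_power: "trig_poly S F \<Longrightarrow> trig_poly S (\<lambda>x. F x ^ n)"
  by (induction n) (auto intro: trig_poly.intros)

text \<open>The dilation by an integer has to stay in the algebra in order to preserve periodicity.\<close>
lemma trig_poly_multiple_angle:
  assumes "i \<in> S"
  shows "trig_poly S (\<lambda>x. cos (real n * x $ i))" "trig_poly S (\<lambda>x. sin (real n * x $ i))"
proof -
  have "trig_poly S (\<lambda>x. cos (real n * x $ i)) \<and> trig_poly S (\<lambda>x. sin (real n * x $ i))"
  proof (induction n)
    case 0
    show ?case by (auto intro: trig_poly.const)
  next
    case (Suc n)
    have "trig_poly S (\<lambda>x. cos (real n * x $ i) * cos (x $ i) + - (sin (real n * x $ i) * sin (x $ i)))"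
      by (intro trig_poly.add trig_poly_minus trig_poly.mult trig_poly.cos trig_poly.sin
          conjunct1[OF Suc] conjunct2[OF Suc] assms)
    moreover have "trig_poly S (\<lambda>x. sin (real n * x $ i) * cos (x $ i) + cos (real n * x $ i) * sin (x $ i))"
      using Suc assms by (auto intro!: trig_poly.intros)
    ultimately show ?case
      by (simp add: algebra_simps cos_add sin_add)
  qed
  then show "trig_poly S (\<lambda>x. cos (real n * x $ i))" "trig_poly S (\<lambda>x. sin (real n * x $ i))"
    by auto
qed

lemma trig_poly_dilate: "trig_poly S F \<Longrightarrow> trig_poly S (\<lambda>x. F (real n *\<^sub>R x))"
  by (induction rule: trig_poly.induct) (auto intro: trig_poly.intros trig_poly_multiple_angle)

lemma trig_poly_differentiable: "trig_poly S F \<Longrightarrow> F differentiable (at x)"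
proof (induction rule: trig_poly.induct)
  case (cos i)
  show ?case
    unfolding differentiable_def
    by (rule exI, rule DERIV_compose_FDERIV[OF DERIV_cos])
      (rule bounded_linear_imp_has_derivative, rule bounded_linear_vec_nth)
next
  case (sin i)
  show ?case
    unfolding differentiable_def
    by (rule exI, rule DERIV_compose_FDERIV[OF DERIV_sin])
      (rule bounded_linear_imp_has_derivative, rule bounded_linear_vec_nth)
qed auto

lemma trig_poly_continuous: "trig_poly S F \<Longrightarrow> continuous_on UNIV F"
  by (meson continuous_at_imp_continuous_on differentiable_imp_continuous_within trig_poly_differentiable)

lemma trig_poly_continuous_fst:
  "trig_poly S F \<Longrightarrow> continuous_on UNIV (\<lambda>p. F (fst p))"
  by (rule continuous_on_compose2[OF trig_poly_continuous continuous_on_fst[OF continuous_on_id]]) auto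

lemma partial_trig_add:
  "trig_poly S F \<Longrightarrow> trig_poly T G \<Longrightarrow>
    partial \<alpha> (\<lambda>x. F x + G x) = (\<lambda>x. partial \<alpha> F x + partial \<alpha> G x)"
  by (auto intro: partial_add trig_poly_differentiable)

lemma partial_trig_mult:
  "trig_poly S F \<Longrightarrow> trig_poly T G \<Longrightarrow>
    partial \<alpha> (\<lambda>x. F x * G x) = (\<lambda>x. F x * partial \<alpha> G x + G x * partial \<alpha> F x)"
  by (auto intro: partial_mult trig_poly_differentiable)

lemma partial_trig_cmult:
  "trig_poly S F \<Longrightarrow> partial \<alpha> (\<lambda>x. c * F x) = (\<lambda>x. c * partial \<alpha> F x)"
  using partial_trig_mult[OF trig_poly.const[of S c]] by auto

lemma partial_trig_dilate:
  "trig_poly S F \<Longrightarrow> partial \<alpha> (\<lambda>x. F (K *\<^sub>R x)) = (\<lambda>x. K * partial \<alpha> F (K *\<^sub>R x))"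
  by (auto intro: partial_dilate trig_poly_differentiable)

lemma partial_cos_coord:
  "partial \<alpha> (\<lambda>x::real^'m::finite. cos (x $ i)) = (\<lambda>x. (if \<alpha> = i then -1 else 0) * sin (x $ i))"
  by (rule ext) (subst partial_coord[OF DERIV_cos], auto)

lemma partial_sin_coord:
  "partial \<alpha> (\<lambda>x::real^'m::finite. sin (x $ i)) = (\<lambda>x. (if \<alpha> = i then 1 else 0) * cos (x $ i))"
  by (rule ext) (subst partial_coord[OF DERIV_sin], auto)

lemma trig_poly_partial: "trig_poly S F \<Longrightarrow> trig_poly S (partial \<alpha> F)"
  by (induction rule: trig_poly.induct)
    (auto simp: partial_cos_coord partial_sin_coord partial_trig_add partial_trig_mult
      intro!: trig_poly.intros trig_poly_minus)

lemma partial_trig_outside: "trig_poly S F \<Longrightarrow> \<alpha> \<notin> S \<Longrightarrow> partial \<alpha> F = (\<lambda>x. 0)"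
  by (induction rule: trig_poly.induct)
    (auto simp: partial_cos_coord partial_sin_coord partial_trig_add partial_trig_mult)

lemma partial_commute: "trig_poly S F \<Longrightarrow> partial \<alpha> (partial \<beta> F) = partial \<beta> (partial \<alpha> F)"
proof (induction rule: trig_poly.induct)
  case (const c)
  show ?case by simp
next
  case (cos i)
  then show ?case
    by (simp add: partial_cos_coord partial_trig_cmult[OF trig_poly.sin[OF cos]] partial_sin_coord)
next
  case (sin i)
  then show ?case
    by (simp add: partial_sin_coord partial_trig_cmult[OF trig_poly.cos[OF sin]] partial_cos_coord)
next
  case (add F G)
  then show ?case
    by (simp add: partial_trig_add[OF add.hyps]
        partial_trig_add[OF trig_poly_partial[OF add.hyps(1)] trig_poly_partial[OF add.hyps(2)]])
next
  case (mult F G)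
  have "partial a (partial b (\<lambda>x. F x * G x)) =
      (\<lambda>x. (F x * partial a (partial b G) x + partial b G x * partial a F x) +
        (G x * partial a (partial b F) x + partial b F x * partial a G x))" for a b
    unfolding partial_trig_mult[OF mult.hyps]
    by (subst partial_trig_add[OF
          trig_poly.mult[OF mult.hyps(1) trig_poly_partial[OF mult.hyps(2)]]
          trig_poly.mult[OF mult.hyps(2) trig_poly_partial[OF mult.hyps(1)]]])
      (simp only: partial_trig_mult[OF mult.hyps(1) trig_poly_partial[OF mult.hyps(2)]]
        partial_trig_mult[OF mult.hyps(2) trig_poly_partial[OF mult.hyps(1)]])
  then show ?case
    by (simp add: mult.IH algebra_simps)
qed

lemma trig_poly_periodic: "trig_poly S F \<Longrightarrow> torus_rel x y \<Longrightarrow> F x = F y"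
proof (induction rule: trig_poly.induct)
  case (cos i)
  then obtain k :: int where "x $ i = y $ i + 2 * pi * of_int k"
    unfolding torus_rel_def by (metis add.commute diff_add_cancel)
  then show ?case by (simp add: cos_add cos_int_2pin sin_int_2pin)
next
  case (sin i)
  then obtain k :: int where "x $ i = y $ i + 2 * pi * of_int k"
    unfolding torus_rel_def by (metis add.commute diff_add_cancel)
  then show ?case by (simp add: sin_add cos_int_2pin sin_int_2pin)
qed auto

lemma trig_poly_bounded: "trig_poly S F \<Longrightarrow> \<exists>B\<ge>0. \<forall>x. \<bar>F x\<bar> \<le> B"
proof (induction rule: trig_poly.induct)
  case (const c)
  show ?case by (rule exI[of _ "\<bar>c\<bar>"]) auto
next
  case (add F G)
  then obtain A B where "\<forall>x. \<bar>F x\<bar> \<le> A" "\<forall>x. \<bar>G x\<bar> \<le> B" "A \<ge> 0" "B \<ge> 0" by blast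
  then show ?case
    by (intro exI[of _ "A + B"]) (auto intro!: abs_triangle_ineq[THEN order_trans] add_mono)
next
  case (mult F G)
  then obtain A B where "\<forall>x. \<bar>F x\<bar> \<le> A" "\<forall>x. \<bar>G x\<bar> \<le> B" "A \<ge> 0" "B \<ge> 0" by blast
  then show ?case
    by (intro exI[of _ "A * B"]) (auto simp: abs_mult intro!: mult_mono)
qed (auto intro!: exI[of _ 1])

section \<open>Second order operators at a point\<close>

definition diffop :: "real^'m::finite \<Rightarrow> real^'m^'m \<Rightarrow> (real^'m \<Rightarrow> real) \<Rightarrow> real^'m \<Rightarrow> real" where
  "diffop l Q F x = (\<Sum>i\<in>UNIV. l $ i * partial i F x) +
    (\<Sum>i\<in>UNIV. \<Sum>j\<in>UNIV. Q $ i $ j * partial i (partial j F) x)"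

text \<open>The bilinear form of \<open>Q\<close> on two gradients, taken at two possibly different points.\<close>
definition polar :: "real^'m::finite^'m \<Rightarrow> (real^'m \<Rightarrow> real) \<Rightarrow> real^'m \<Rightarrow> (real^'m \<Rightarrow> real) \<Rightarrow> real^'m \<Rightarrow> real" where
  "polar Q F y G x = (\<Sum>i\<in>UNIV. \<Sum>j\<in>UNIV. Q $ i $ j * (partial i F y * partial j G x))"

text \<open>
  Operators in the coordinates of \<open>S\<close>. With \<open>Q\<close> symmetric, each second order operator is counted
  once, and \<open>2 Q\<^sub>i\<^sub>j\<close> is the coefficient of \<open>\<partial>\<^sub>i\<partial>\<^sub>j\<close> for \<open>i \<noteq> j\<close>.
\<close>
definition op_space :: "'m::finite set \<Rightarrow> ((real^'m) \<times> (real^'m^'m)) set" where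
  "op_space S = {(l, Q). (\<forall>i. i \<notin> S \<longrightarrow> l $ i = 0) \<and> (\<forall>i j. i \<notin> S \<longrightarrow> Q $ i $ j = 0) \<and>
    (\<forall>i j. Q $ i $ j = Q $ j $ i)}"

lemma diffop_add:
  assumes "trig_poly S F" "trig_poly T G"
  shows "diffop l Q (\<lambda>x. F x + G x) x = diffop l Q F x + diffop l Q G x"
proof -
  have "partial i (partial j (\<lambda>x. F x + G x)) x = partial i (partial j F) x + partial i (partial j G) x" for i j
    by (simp add: partial_trig_add[OF assms]
        partial_trig_add[OF trig_poly_partial[OF assms(1)] trig_poly_partial[OF assms(2)]])
  then show ?thesis
    by (simp add: diffop_def partial_trig_add[OF assms] algebra_simps sum.distrib)
qed

lemma diffop_cmult:
  assumes "trig_poly S F"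
  shows "diffop l Q (\<lambda>x. c * F x) x = c * diffop l Q F x"
proof -
  have "partial i (partial j (\<lambda>x. c * F x)) x = c * partial i (partial j F) x" for i j
    by (simp add: partial_trig_cmult[OF assms] partial_trig_cmult[OF trig_poly_partial[OF assms]])
  then show ?thesis
    by (simp add: diffop_def partial_trig_cmult[OF assms] algebra_simps sum_distrib_left)
qed

lemma diffop_scale: "diffop (s *\<^sub>R l) (s *\<^sub>R Q) F x = s * diffop l Q F x"
  by (simp add: diffop_def algebra_simps sum_distrib_left)

lemma diffop_mult:
  assumes F: "trig_poly S F" and G: "trig_poly T G" and sym: "\<And>i j. Q $ i $ j = Q $ j $ i"
  shows "diffop l Q (\<lambda>x. F x * G x) x = F x * diffop l Q G x + G x * diffop l Q F x + 2 * polar Q F x G x"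
proof -
  have 2: "partial i (partial j (\<lambda>x. F x * G x)) x =
     (F x * partial i (partial j G) x + partial j G x * partial i F x) +
     (G x * partial i (partial j F) x + partial j F x * partial i G x)" for i j
    unfolding partial_trig_mult[OF F G]
    by (subst partial_trig_add[OF
          trig_poly.mult[OF trig_poly_mono[OF F] trig_poly_partial[OF trig_poly_mono[OF G]], of "S \<union> T"]
          trig_poly.mult[OF trig_poly_mono[OF G] trig_poly_partial[OF trig_poly_mono[OF F]], of "S \<union> T"]])
      (auto simp: partial_trig_mult[OF F trig_poly_partial[OF G]]
        partial_trig_mult[OF G trig_poly_partial[OF F]])
  have "(\<Sum>i\<in>UNIV. \<Sum>j\<in>UNIV. Q $ i $ j * (partial j F x * partial i G x)) = polar Q F x G x"
    unfolding polar_def by (subst sum.swap) (simp add: sym)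
  moreover have "(\<Sum>i\<in>UNIV. \<Sum>j\<in>UNIV. Q $ i $ j * partial i (partial j (\<lambda>x. F x * G x)) x) =
      F x * (\<Sum>i\<in>UNIV. \<Sum>j\<in>UNIV. Q $ i $ j * partial i (partial j G) x) +
      G x * (\<Sum>i\<in>UNIV. \<Sum>j\<in>UNIV. Q $ i $ j * partial i (partial j F) x) +
      polar Q F x G x +
      (\<Sum>i\<in>UNIV. \<Sum>j\<in>UNIV. Q $ i $ j * (partial j F x * partial i G x))"
    unfolding 2 polar_def sum_distrib_left sum.distrib[symmetric]
    by (intro sum.cong refl) (simp add: algebra_simps)
  moreover have "(\<Sum>i\<in>UNIV. l $ i * partial i (\<lambda>x. F x * G x) x) =
      F x * (\<Sum>i\<in>UNIV. l $ i * partial i G x) + G x * (\<Sum>i\<in>UNIV. l $ i * partial i F x)"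
    unfolding partial_trig_mult[OF F G] sum_distrib_left sum.distrib[symmetric]
    by (intro sum.cong refl) (simp add: algebra_simps)
  ultimately show ?thesis
    unfolding diffop_def by (simp add: distrib_left)
qed

lemma trig_poly_dilate_differentiable:
  "trig_poly S F \<Longrightarrow> (\<lambda>x. F (K *\<^sub>R x)) differentiable (at x)"
  using differentiable_chain_at[of "\<lambda>x. K *\<^sub>R x" x F] trig_poly_differentiable[of S F]
  by (simp add: o_def)

lemma diffop_dilate:
  assumes "trig_poly S F"
  shows "diffop l Q (\<lambda>x. F (K *\<^sub>R x)) x = diffop (K *\<^sub>R l) (K\<^sup>2 *\<^sub>R Q) F (K *\<^sub>R x)"
proof -
  have "partial i (partial j (\<lambda>x. F (K *\<^sub>R x))) x = K\<^sup>2 * partial i (partial j F) (K *\<^sub>R x)" for i j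
  proof -
    have "partial i (\<lambda>x. K * partial j F (K *\<^sub>R x)) x = K * (K * partial i (partial j F) (K *\<^sub>R x))"
      by (subst partial_mult)
        (simp_all add: trig_poly_dilate_differentiable[OF trig_poly_partial[OF assms]]
          partial_trig_dilate[OF trig_poly_partial[OF assms]])
    then show ?thesis by (simp add: partial_trig_dilate[OF assms] power2_eq_square)
  qed
  then show ?thesis
    by (simp add: diffop_def partial_trig_dilate[OF assms] algebra_simps)
qed

lemma polar_dilate:
  assumes "trig_poly S F"
  shows "polar Q (\<lambda>x. F (K *\<^sub>R x)) y G x = K * polar Q F (K *\<^sub>R y) G x"
  by (simp add: polar_def partial_trig_dilate[OF assms] algebra_simps sum_distrib_left)

lemma abs_double_sum_le:
  fixes f :: "'a::finite \<Rightarrow> 'b::finite \<Rightarrow> real"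
  assumes "\<And>i j. \<bar>f i j\<bar> \<le> g i j * c"
  shows "\<bar>\<Sum>i\<in>UNIV. \<Sum>j\<in>UNIV. f i j\<bar> \<le> (\<Sum>i\<in>UNIV. \<Sum>j\<in>UNIV. g i j) * c"
proof -
  have "\<bar>\<Sum>i\<in>UNIV. \<Sum>j\<in>UNIV. f i j\<bar> \<le> (\<Sum>i\<in>UNIV. \<Sum>j\<in>UNIV. \<bar>f i j\<bar>)"
    by (intro order_trans[OF sum_abs] sum_mono sum_abs)
  also have "\<dots> \<le> (\<Sum>i\<in>UNIV. \<Sum>j\<in>UNIV. g i j * c)"
    by (intro sum_mono assms)
  finally show ?thesis by (simp add: sum_distrib_right)
qed

lemma matrix_entry_le_norm: "\<bar>Q $ i $ j\<bar> \<le> norm (Q :: real^'m::finite^'m)"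
  using component_le_norm_cart[of "Q $ i" j] Finite_Cartesian_Product.norm_nth_le[of Q i] by linarith

lemma polar_bounded:
  fixes F G :: "real^'m::finite \<Rightarrow> real"
  assumes F: "trig_poly S F" and G: "trig_poly T G"
  shows "\<exists>B\<ge>0. \<forall>Q y x. \<bar>polar Q F y G x\<bar> \<le> B * norm Q"
proof -
  have "\<forall>i. \<exists>B\<ge>0. \<forall>x. \<bar>partial i F x\<bar> \<le> B"
    using trig_poly_bounded[OF trig_poly_partial[OF F]] by blast
  then obtain A where A: "\<And>i. A i \<ge> 0" "\<And>i x. \<bar>partial i F x\<bar> \<le> A i" by metis
  have "\<forall>i. \<exists>B\<ge>0. \<forall>x. \<bar>partial i G x\<bar> \<le> B"
    using trig_poly_bounded[OF trig_poly_partial[OF G]] by blast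
  then obtain B where B: "\<And>i. B i \<ge> 0" "\<And>i x. \<bar>partial i G x\<bar> \<le> B i" by metis
  have "\<bar>polar Q F y G x\<bar> \<le> (\<Sum>i\<in>UNIV. \<Sum>j\<in>UNIV. A i * B j) * norm Q" for Q y x
    unfolding polar_def
  proof (rule abs_double_sum_le)
    fix i j
    show "\<bar>Q $ i $ j * (partial i F y * partial j G x)\<bar> \<le> A i * B j * norm Q"
      using mult_mono[OF matrix_entry_le_norm[of Q i j] mult_mono[OF A(2)[of i y] B(2)[of j x]]] A(1) B(1)
      by (simp add: abs_mult algebra_simps)
  qed
  then show ?thesis
    using A(1) B(1) by (intro exI[of _ "\<Sum>i\<in>UNIV. \<Sum>j\<in>UNIV. A i * B j"]) (auto intro!: sum_nonneg)
qed

lemma diffop_bounded: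
  fixes F :: "real^'m::finite \<Rightarrow> real"
  assumes F: "trig_poly S F"
  shows "\<exists>B\<ge>0. \<forall>l Q x. \<bar>diffop l Q F x\<bar> \<le> B * norm (l, Q)"
proof -
  have "\<forall>i. \<exists>B\<ge>0. \<forall>x. \<bar>partial i F x\<bar> \<le> B"
    using trig_poly_bounded[OF trig_poly_partial[OF F]] by blast
  then obtain A where A: "\<And>i. A i \<ge> 0" "\<And>i x. \<bar>partial i F x\<bar> \<le> A i" by metis
  have "\<forall>i j. \<exists>B\<ge>0. \<forall>x. \<bar>partial i (partial j F) x\<bar> \<le> B"
    using trig_poly_bounded[OF trig_poly_partial[OF trig_poly_partial[OF F]]] by blast
  then obtain B where B: "\<And>i j. B i j \<ge> 0" "\<And>i j x. \<bar>partial i (partial j F) x\<bar> \<le> B i j" by metis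
  have "\<bar>diffop l Q F x\<bar> \<le> ((\<Sum>i\<in>UNIV. A i) + (\<Sum>i\<in>UNIV. \<Sum>j\<in>UNIV. B i j)) * norm (l, Q)" for l Q x
  proof -
    have "\<bar>\<Sum>i\<in>UNIV. l $ i * partial i F x\<bar> \<le> (\<Sum>i\<in>UNIV. A i) * norm (l, Q)"
      unfolding sum_distrib_right
    proof (intro order_trans[OF sum_abs] sum_mono)
      fix i
      have "\<bar>l $ i\<bar> \<le> norm (l, Q)"
        using component_le_norm_cart[of l i] norm_fst_le[of l Q] by linarith
      from mult_mono[OF this A(2)[of i x]]
      show "\<bar>l $ i * partial i F x\<bar> \<le> A i * norm (l, Q)" by (simp add: abs_mult mult.commute)
    qed
    moreover have "\<bar>\<Sum>i\<in>UNIV. \<Sum>j\<in>UNIV. Q $ i $ j * partial i (partial j F) x\<bar> \<le>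
        (\<Sum>i\<in>UNIV. \<Sum>j\<in>UNIV. B i j) * norm (l, Q)"
    proof (rule abs_double_sum_le)
      fix i j
      have "\<bar>Q $ i $ j\<bar> \<le> norm (l, Q)"
        using matrix_entry_le_norm[of Q i j] norm_snd_le[of Q l] by linarith
      from mult_mono[OF this B(2)[of i j x]]
      show "\<bar>Q $ i $ j * partial i (partial j F) x\<bar> \<le> B i j * norm (l, Q)" by (simp add: abs_mult mult.commute)
    qed
    ultimately show ?thesis unfolding diffop_def distrib_right by linarith
  qed
  then show ?thesis
    using A(1) B(1) by (intro exI[of _ "(\<Sum>i\<in>UNIV. A i) + (\<Sum>i\<in>UNIV. \<Sum>j\<in>UNIV. B i j)"])
      (auto intro!: sum_nonneg add_nonneg_nonneg)
qed

text \<open>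
  Acting on \<open>F(Kx)\<close> amounts to acting on \<open>F\<close> by the operator \<open>(K l, K\<^sup>2 Q)\<close>. Measured in that norm,
  the same operator acting on an undilated function gains a factor \<open>1/K\<close>.
\<close>
lemma norm_dilated_op:
  fixes l :: "real^'m::finite"
  assumes "K \<ge> 1"
  shows "norm (l, Q) \<le> norm (K *\<^sub>R l, K\<^sup>2 *\<^sub>R Q) / K"
proof -
  have "K * norm (l, Q) = norm (K *\<^sub>R l, K *\<^sub>R Q)"
    using norm_scaleR[of K "(l, Q)"] assms by simp
  also have "\<dots> \<le> norm (K *\<^sub>R l, K\<^sup>2 *\<^sub>R Q)"
  proof -
    have "K \<le> K\<^sup>2" using assms by (simp add: power2_eq_square)
    then have "K * norm Q \<le> K\<^sup>2 * norm Q" by (intro mult_right_mono) auto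
    then show ?thesis
      unfolding norm_Pair using assms by (auto intro!: real_sqrt_le_mono power_mono)
  qed
  finally show ?thesis using assms by (simp add: field_simps)
qed

text \<open>This is the compactness of the torus, expressed on its universal cover.\<close>
lemma torus_compact_rep: "\<exists>y\<in>cbox 0 (\<chi> i. 2 * pi). torus_rel (x::real^'m::finite) y"
proof
  let ?k = "\<lambda>i. \<lfloor>x $ i / (2 * pi)\<rfloor>"
  let ?y = "\<chi> i. x $ i - 2 * pi * of_int (?k i)"
  show "torus_rel x ?y"
    unfolding torus_rel_def by (auto intro!: exI)
  have "0 \<le> ?y $ i \<and> ?y $ i \<le> 2 * pi" for i
  proof -
    show ?thesis
      using floor_divide_lower[of "2 * pi" "x $ i"] floor_divide_upper[of "2 * pi" "x $ i"]
      by (simp add: algebra_simps)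
  qed
  then show "?y \<in> cbox 0 (\<chi> i. 2 * pi)"
    by (auto simp: mem_box_cart)
qed

text \<open>
  Pointwise injectivity of a continuous periodic family of linear maps on \<open>V\<close>, measured by
  \<open>\<Phi> x v\<close>, has a uniform lower bound because the torus and the unit sphere of \<open>V\<close> are compact.
  This is what makes injectivity survive errors of order \<open>1/n\<close>.
\<close>
lemma uniform_injectivity_torus:
  fixes \<Phi> :: "real^'m::finite \<Rightarrow> 'v::euclidean_space \<Rightarrow> real"
  assumes cont: "continuous_on UNIV (\<lambda>p. \<Phi> (fst p) (snd p))"
    and per: "\<And>x y v. torus_rel x y \<Longrightarrow> \<Phi> x v = \<Phi> y v"
    and hom: "\<And>x v s. \<Phi> x (s *\<^sub>R v) = \<bar>s\<bar> * \<Phi> x v"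
    and V: "subspace V"
    and pos: "\<And>x v. v \<in> V \<Longrightarrow> v \<noteq> 0 \<Longrightarrow> \<Phi> x v > 0"
  shows "\<exists>c>0. \<forall>x. \<forall>v\<in>V. c * norm v \<le> \<Phi> x v"
proof -
  let ?K = "cbox 0 (\<chi> i. 2 * pi) \<times> (sphere 0 1 \<inter> V) :: ((real^'m) \<times> 'v) set"
  have K: "compact ?K"
    by (intro compact_Times compact_cbox compact_Int_closed compact_sphere closed_subspace V)
  have "\<exists>c>0. \<forall>p\<in>?K. c \<le> \<Phi> (fst p) (snd p)"
  proof (cases "?K = {}")
    case True
    then show ?thesis by (intro exI[of _ 1]) auto
  next
    case False
    obtain p where p: "p \<in> ?K" "\<And>r. r \<in> ?K \<Longrightarrow> \<Phi> (fst p) (snd p) \<le> \<Phi> (fst r) (snd r)"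
      using continuous_attains_inf[OF K False continuous_on_subset[OF cont]] by auto
    have "\<Phi> (fst p) (snd p) > 0"
      using p(1) by (intro pos) auto
    with p(2) show ?thesis by blast
  qed
  then obtain c where c: "c > 0" "\<And>x v. x \<in> cbox 0 (\<chi> i. 2 * pi) \<Longrightarrow> norm v = 1 \<Longrightarrow> v \<in> V \<Longrightarrow> c \<le> \<Phi> x v"
    by fastforce
  have "c * norm v \<le> \<Phi> x v" if v: "v \<in> V" for x v
  proof (cases "v = 0")
    case True
    then show ?thesis using hom[of x 0 v] by simp
  next
    case False
    obtain y where y: "y \<in> cbox 0 (\<chi> i. 2 * pi)" "torus_rel x y" using torus_compact_rep by blast
    have "c \<le> \<Phi> y ((1 / norm v) *\<^sub>R v)"
      using False v V by (intro c(2) y) (auto intro: subspace_scale)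
    also have "\<dots> = \<Phi> x v / norm v"
      using per[OF y(2)] by (simp add: hom)
    finally show ?thesis using False by (simp add: field_simps)
  qed
  with c(1) show ?thesis by blast
qed

section \<open>Separating one coordinate\<close>

lemma sum_UNIV_single: "(\<And>i. i \<noteq> t \<Longrightarrow> f i = 0) \<Longrightarrow> sum f UNIV = f (t::'a::finite)"
  by (subst sum.remove[of _ t]) auto

text \<open>
  An operator in the coordinates \<open>insert t S\<close> splits into its part in the coordinates \<open>S\<close>
  (\<open>cut_vec\<close>, \<open>cut_mat\<close>), its part in \<open>t\<close> alone (the entries \<open>l $ t\<close> and \<open>Q $ t $ t\<close>), and its mixed part
  (\<open>cross\<close>).
\<close>
definition cut_vec :: "'m \<Rightarrow> real^'m::finite \<Rightarrow> real^'m" where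
  "cut_vec t l = (\<chi> i. if i = t then 0 else l $ i)"

definition cut_mat :: "'m \<Rightarrow> real^'m::finite^'m \<Rightarrow> real^'m^'m" where
  "cut_mat t Q = (\<chi> i j. if i = t \<or> j = t then 0 else Q $ i $ j)"

definition cross :: "'m \<Rightarrow> real^'m::finite^'m \<Rightarrow> real^'m" where
  "cross t Q = (\<chi> i. if i = t then 0 else Q $ i $ t)"

lemma cut_op_space:
  "(l, Q) \<in> op_space (insert t S) \<Longrightarrow> (cut_vec t l, cut_mat t Q) \<in> op_space S"
  by (auto simp: op_space_def cut_vec_def cut_mat_def)

lemma diffop_inner:
  assumes F: "trig_poly S F" and t: "t \<notin> S"
  shows "diffop l Q F x = diffop (cut_vec t l) (cut_mat t Q) F x"
proof -
  note 0 = partial_trig_outside[OF _ t]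
  show ?thesis
    unfolding diffop_def cut_vec_def cut_mat_def
    by (intro arg_cong2[of _ _ _ _ "(+)"] sum.cong) (auto simp: 0[OF F] 0[OF trig_poly_partial[OF F]])
qed

lemma diffop_outer:
  assumes G: "trig_poly {t} G"
  shows "diffop l Q G x = l $ t * partial t G x + Q $ t $ t * partial t (partial t G) x"
proof -
  have 0: "partial i G = (\<lambda>x. 0)" "partial i (partial j G) = (\<lambda>x. 0)" if "i \<noteq> t" for i j
    using that partial_trig_outside[OF G] partial_trig_outside[OF trig_poly_partial[OF G]] by auto
  have "(\<Sum>j\<in>UNIV. Q $ t $ j * partial t (partial j G) x) = Q $ t $ t * partial t (partial t G) x"
    by (rule sum_UNIV_single) (simp add: 0)
  then show ?thesis
    unfolding diffop_def
    by (subst (1 2) sum_UNIV_single[of t]) (auto simp: 0)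
qed

lemma diffop_split_mult:
  assumes F: "trig_poly S F" and G: "trig_poly {t} G" and t: "t \<notin> S"
    and sym: "\<And>i j. Q $ i $ j = Q $ j $ i"
  shows "diffop l Q (\<lambda>x. G x * F x) x =
    (l $ t * partial t G x + Q $ t $ t * partial t (partial t G) x) * F x +
    G x * diffop (cut_vec t l) (cut_mat t Q) F x +
    2 * partial t G x * (\<Sum>i\<in>UNIV. cross t Q $ i * partial i F x)"
proof -
  have 0: "partial i G = (\<lambda>x. 0)" if "i \<noteq> t" for i
    using that partial_trig_outside[OF G] by auto
  have "polar Q G x F x = (\<Sum>j\<in>UNIV. Q $ t $ j * (partial t G x * partial j F x))"
    unfolding polar_def by (rule sum_UNIV_single) (simp add: 0)
  also have "\<dots> = (\<Sum>j\<in>UNIV. partial t G x * (cross t Q $ j * partial j F x))"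
  proof (intro sum.cong refl)
    fix j
    show "Q $ t $ j * (partial t G x * partial j F x) = partial t G x * (cross t Q $ j * partial j F x)"
      using partial_trig_outside[OF F t] sym[of t j] by (cases "j = t") (simp_all add: cross_def)
  qed
  finally have "polar Q G x F x = partial t G x * (\<Sum>j\<in>UNIV. cross t Q $ j * partial j F x)"
    by (simp add: sum_distrib_left)
  then show ?thesis
    by (simp add: diffop_mult[OF G F sym] diffop_outer[OF G] flip: diffop_inner[OF F t])
qed

section \<open>Two-scale asymptotics\<close>

text \<open>
  The norm of an operator after the rescaling by \<open>n\<close> for first and \<open>n\<^sup>2\<close> for second derivatives that is
  natural on functions of \<open>nx\<close> and of \<open>nt\<close>. The mixed part is left out: it acts on
  functions of amplitude \<open>1/n\<close> only and is kept exactly.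
\<close>
definition op_size :: "'m::finite \<Rightarrow> nat \<Rightarrow> real^'m \<Rightarrow> real^'m^'m \<Rightarrow> real" where
  "op_size t n l Q =
    norm (real n *\<^sub>R cut_vec t l, (real n)\<^sup>2 *\<^sub>R cut_mat t Q) + (\<bar>real n * l $ t\<bar> + \<bar>(real n)\<^sup>2 * Q $ t $ t\<bar>)"

text \<open>
  Errors that are smaller than the rescaled operator by a factor \<open>1/n\<close>, uniformly in the point and
  the operator.
\<close>
definition negligible :: "'m::finite \<Rightarrow> (nat \<Rightarrow> real^'m \<Rightarrow> real^'m \<Rightarrow> real^'m^'m \<Rightarrow> real) \<Rightarrow> bool" where
  "negligible t E \<longleftrightarrow> (\<exists>B\<ge>0. \<forall>n\<ge>1. \<forall>x l Q. (\<forall>i j. Q $ i $ j = Q $ j $ i) \<longrightarrow>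
    \<bar>E n x l Q\<bar> \<le> B * op_size t n l Q / real n)"

definition bounded_family :: "(nat \<Rightarrow> real^'m::finite \<Rightarrow> real) \<Rightarrow> bool" where
  "bounded_family g \<longleftrightarrow> (\<exists>B\<ge>0. \<forall>n\<ge>1. \<forall>x. \<bar>g n x\<bar> \<le> B)"

lemma bounded_family_trig:
  assumes "trig_poly S F"
  shows "bounded_family (\<lambda>n x. F (y n x))"
proof -
  obtain B where "B \<ge> 0" "\<forall>x. \<bar>F x\<bar> \<le> B" using trig_poly_bounded[OF assms] by blast
  then show ?thesis unfolding bounded_family_def by auto
qed

lemma bounded_family_unit: "(\<And>n x. n \<ge> 1 \<Longrightarrow> \<bar>g n x\<bar> \<le> 1) \<Longrightarrow> bounded_family g"
  unfolding bounded_family_def by (auto intro!: exI[of _ 1])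

lemma bounded_family_mult:
  assumes "bounded_family g" "bounded_family h"
  shows "bounded_family (\<lambda>n x. g n x * h n x)"
proof -
  obtain A B where "A \<ge> 0" "B \<ge> 0" "\<And>n x. n \<ge> 1 \<Longrightarrow> \<bar>g n x\<bar> \<le> A" "\<And>n x. n \<ge> 1 \<Longrightarrow> \<bar>h n x\<bar> \<le> B"
    using assms unfolding bounded_family_def by metis
  then show ?thesis
    unfolding bounded_family_def by (intro exI[of _ "A * B"]) (auto simp: abs_mult intro!: mult_mono)
qed

lemma negligible_zero: "negligible t (\<lambda>n x l Q. 0)"
  unfolding negligible_def by (auto intro!: exI[of _ 0])

lemma negligible_add:
  assumes "negligible t E" "negligible t F"
  shows "negligible t (\<lambda>n x l Q. E n x l Q + F n x l Q)"
proof -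
  obtain A where A: "A \<ge> 0" "\<And>n x l Q. n \<ge> 1 \<Longrightarrow> \<forall>i j. Q $ i $ j = Q $ j $ i \<Longrightarrow>
      \<bar>E n x l Q\<bar> \<le> A * op_size t n l Q / real n"
    using assms(1) unfolding negligible_def by metis
  obtain B where B: "B \<ge> 0" "\<And>n x l Q. n \<ge> 1 \<Longrightarrow> \<forall>i j. Q $ i $ j = Q $ j $ i \<Longrightarrow>
      \<bar>F n x l Q\<bar> \<le> B * op_size t n l Q / real n"
    using assms(2) unfolding negligible_def by metis
  show ?thesis
    unfolding negligible_def
  proof (intro exI[of _ "A + B"] conjI allI impI)
    fix n :: nat and x l and Q :: "real^'a^'a"
    assume "1 \<le> n" "\<forall>i j. Q $ i $ j = Q $ j $ i"
    from A(2)[OF this, of x l] B(2)[OF this, of x l]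
    show "\<bar>E n x l Q + F n x l Q\<bar> \<le> (A + B) * op_size t n l Q / real n"
      by (simp add: distrib_right add_divide_distrib)
  qed (use A B in auto)
qed

lemma negligible_mult:
  assumes "bounded_family g" "negligible t E"
  shows "negligible t (\<lambda>n x l Q. g n x * E n x l Q)"
proof -
  obtain A where A: "A \<ge> 0" "\<And>n x. n \<ge> 1 \<Longrightarrow> \<bar>g n x\<bar> \<le> A"
    using assms(1) unfolding bounded_family_def by metis
  obtain B where B: "B \<ge> 0" "\<And>n x l Q. n \<ge> 1 \<Longrightarrow> \<forall>i j. Q $ i $ j = Q $ j $ i \<Longrightarrow>
      \<bar>E n x l Q\<bar> \<le> B * op_size t n l Q / real n"
    using assms(2) unfolding negligible_def by metis
  show ?thesis
    unfolding negligible_def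
  proof (intro exI[of _ "A * B"] conjI allI impI)
    fix n :: nat and x l and Q :: "real^'a^'a"
    assume n: "1 \<le> n" "\<forall>i j. Q $ i $ j = Q $ j $ i"
    show "\<bar>g n x * E n x l Q\<bar> \<le> A * B * op_size t n l Q / real n"
      using mult_mono[OF A(2)[OF n(1), of x] B(2)[OF n, of x l]] A(1) by (simp add: abs_mult mult.assoc)
  qed (use A B in auto)
qed

lemma negligible_minus: "negligible t E \<Longrightarrow> negligible t (\<lambda>n x l Q. - E n x l Q)"
  unfolding negligible_def by simp

lemma negligible_diff:
  "negligible t E \<Longrightarrow> negligible t F \<Longrightarrow> negligible t (\<lambda>n x l Q. E n x l Q - F n x l Q)"
  using negligible_add[OF _ negligible_minus] by fastforce

lemma negligible_cong:
  assumes "negligible t E"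
    and "\<And>n x l Q. n \<ge> 1 \<Longrightarrow> (\<And>i j. Q $ i $ j = Q $ j $ i) \<Longrightarrow> F n x l Q = E n x l Q"
  shows "negligible t F"
  using assms unfolding negligible_def by metis

lemma negligible_first: "negligible t (\<lambda>n x l Q. l $ t)"
  unfolding negligible_def
  by (intro exI[of _ 1]) (auto simp: op_size_def field_simps abs_mult)

lemma negligible_second: "negligible t (\<lambda>n x l Q. real n * Q $ t $ t)"
  unfolding negligible_def
  by (intro exI[of _ 1]) (auto simp: op_size_def field_simps abs_mult power2_eq_square)

lemma negligible_second': "negligible t (\<lambda>n x l Q. Q $ t $ t)"
proof (rule negligible_cong[OF negligible_mult[OF _ negligible_second]])
  show "bounded_family (\<lambda>n x. 1 / real n)" by (rule bounded_family_unit) auto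
qed auto

text \<open>On a slowly varying function the operator loses at least one power of \<open>n\<close>.\<close>
lemma negligible_slow_diffop:
  assumes "trig_poly S F"
  shows "negligible t (\<lambda>n x l Q. diffop (cut_vec t l) (cut_mat t Q) F (y n x))"
proof -
  obtain B where B: "B \<ge> 0" "\<And>l Q x. \<bar>diffop l Q F x\<bar> \<le> B * norm (l, Q)"
    using diffop_bounded[OF assms] by blast
  have "\<bar>diffop (cut_vec t l) (cut_mat t Q) F (y n x)\<bar> \<le> B * op_size t n l Q / real n" if "n \<ge> 1" for n x l Q
  proof -
    have "norm (cut_vec t l, cut_mat t Q) \<le> op_size t n l Q / real n"
      using that
      by (intro order_trans[OF norm_dilated_op[of "real n"]]) (auto simp: op_size_def intro!: divide_right_mono)
    from mult_left_mono[OF this B(1)] B(2)[of "cut_vec t l" "cut_mat t Q" "y n x"]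
    show ?thesis by simp
  qed
  with B(1) show ?thesis unfolding negligible_def by blast
qed

text \<open>
  The product rule for \<open>F(nx) G(x)\<close> has a term with one derivative on each factor; it
  uses only one of the two powers of \<open>n\<close> that weigh \<open>Q\<close>.
\<close>
lemma negligible_slow_polar:
  assumes "trig_poly S F" "trig_poly T G"
  shows "negligible t (\<lambda>n x l Q. real n * polar (cut_mat t Q) F (y n x) G x)"
proof -
  obtain B where B: "B \<ge> 0" "\<And>Q y x. \<bar>polar Q F y G x\<bar> \<le> B * norm Q"
    using polar_bounded[OF assms] by blast
  have "\<bar>real n * polar (cut_mat t Q) F (y n x) G x\<bar> \<le> B * op_size t n l Q / real n" if "n \<ge> 1" for n x l Q
  proof -
    have "norm ((real n)\<^sup>2 *\<^sub>R cut_mat t Q) \<le> norm (real n *\<^sub>R cut_vec t l, (real n)\<^sup>2 *\<^sub>R cut_mat t Q)"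
      by (rule norm_snd_le)
    then have "(real n)\<^sup>2 * norm (cut_mat t Q) \<le> op_size t n l Q"
      by (simp add: op_size_def)
    then have "real n * norm (cut_mat t Q) \<le> op_size t n l Q / real n"
      using that by (simp add: field_simps power2_eq_square)
    from mult_left_mono[OF this B(1)] mult_left_mono[OF B(2)[of "cut_mat t Q" "y n x" x], of "real n"]
    show ?thesis by (simp add: abs_mult algebra_simps)
  qed
  with B(1) show ?thesis unfolding negligible_def by blast
qed

text \<open>
  The values on \<open>cos nt\<close> and \<open>sin nt\<close> of the part of the operator in \<open>t\<close>. They arise
  from the pair \<open>(n l\<^sub>t, n\<^sup>2 Q\<^sub>t\<^sub>t)\<close> by an orthogonal map, so they control it.
\<close>
definition lead_cos :: "'m::finite \<Rightarrow> nat \<Rightarrow> real^'m \<Rightarrow> real^'m \<Rightarrow> real^'m^'m \<Rightarrow> real" where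
  "lead_cos t n x l Q = - (real n * l $ t * sin (real n * x $ t)) - (real n)\<^sup>2 * Q $ t $ t * cos (real n * x $ t)"

definition lead_sin :: "'m::finite \<Rightarrow> nat \<Rightarrow> real^'m \<Rightarrow> real^'m \<Rightarrow> real^'m^'m \<Rightarrow> real" where
  "lead_sin t n x l Q = real n * l $ t * cos (real n * x $ t) - (real n)\<^sup>2 * Q $ t $ t * sin (real n * x $ t)"

lemma partial_cos_multiple:
  "partial t (\<lambda>x::real^'m::finite. cos (real n * x $ t)) = (\<lambda>x. (- real n) * sin (real n * x $ t))"
  by (rule ext, subst partial_coord[where g = "\<lambda>y. cos (real n * y)"])
    (auto intro!: derivative_eq_intros)

lemma partial_sin_multiple:
  "partial t (\<lambda>x::real^'m::finite. sin (real n * x $ t)) = (\<lambda>x. real n * cos (real n * x $ t))"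
  by (rule ext, subst partial_coord[where g = "\<lambda>y. sin (real n * y)"])
    (auto intro!: derivative_eq_intros)

lemma partial2_trig_mult:
  assumes F: "trig_poly S F" and G: "trig_poly S G"
  shows "partial t (partial t (\<lambda>x. F x * G x)) x =
    F x * partial t (partial t G) x + 2 * partial t F x * partial t G x + G x * partial t (partial t F) x"
  unfolding partial_trig_mult[OF F G]
  by (subst partial_trig_add[OF trig_poly.mult[OF F trig_poly_partial[OF G]] trig_poly.mult[OF G trig_poly_partial[OF F]]])
    (simp add: partial_trig_mult[OF F trig_poly_partial[OF G]] partial_trig_mult[OF G trig_poly_partial[OF F]])

lemma fast_cos_asymptotics:
  assumes G: "trig_poly {t} G"
  shows "negligible t (\<lambda>n x l Q. diffop l Q (\<lambda>x. G x * cos (real n * x $ t)) x - G x * lead_cos t n x l Q)"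
proof (rule negligible_cong)
  have c: "bounded_family (\<lambda>n x. cos (real n * x $ t))" and s: "bounded_family (\<lambda>n x. sin (real n * x $ t))"
    by (rule bounded_family_unit, simp)+
  show "negligible t (\<lambda>n x l Q. (cos (real n * x $ t) * partial t G x) * l $ t
      + (cos (real n * x $ t) * partial t (partial t G) x) * Q $ t $ t
      + ((-2) * (sin (real n * x $ t) * partial t G x)) * (real n * Q $ t $ t))"
    using bounded_family_trig[OF trig_poly.const[of "{}" "-2"]]
    by (intro negligible_add negligible_mult negligible_first negligible_second negligible_second'
        bounded_family_mult c s bounded_family_trig[OF trig_poly_partial[OF G]]
        bounded_family_trig[OF trig_poly_partial[OF trig_poly_partial[OF G]]])
next
  fix n x l and Q :: "real^'a^'a"
  have C: "trig_poly {t} (\<lambda>x. cos (real n * x $ t))" and S: "trig_poly {t} (\<lambda>x. sin (real n * x $ t))"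
    by (auto intro: trig_poly_multiple_angle)
  have C2: "partial t (partial t (\<lambda>x. cos (real n * x $ t))) x = - ((real n)\<^sup>2 * cos (real n * x $ t))"
    unfolding partial_cos_multiple partial_trig_cmult[OF S] partial_sin_multiple
    by (simp add: power2_eq_square)
  show "diffop l Q (\<lambda>x. G x * cos (real n * x $ t)) x - G x * lead_cos t n x l Q =
      (cos (real n * x $ t) * partial t G x) * l $ t
      + (cos (real n * x $ t) * partial t (partial t G) x) * Q $ t $ t
      + ((-2) * (sin (real n * x $ t) * partial t G x)) * (real n * Q $ t $ t)"
    unfolding diffop_outer[OF trig_poly.mult[OF G C]] partial2_trig_mult[OF G C] C2
    unfolding partial_trig_mult[OF G C] partial_cos_multiple lead_cos_def
    by (simp add: algebra_simps)
qed

lemma fast_sin_asymptotics: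
  assumes G: "trig_poly {t} G"
  shows "negligible t (\<lambda>n x l Q. diffop l Q (\<lambda>x. G x * sin (real n * x $ t)) x - G x * lead_sin t n x l Q)"
proof (rule negligible_cong)
  have c: "bounded_family (\<lambda>n x. cos (real n * x $ t))" and s: "bounded_family (\<lambda>n x. sin (real n * x $ t))"
    by (rule bounded_family_unit, simp)+
  show "negligible t (\<lambda>n x l Q. (sin (real n * x $ t) * partial t G x) * l $ t
      + (sin (real n * x $ t) * partial t (partial t G) x) * Q $ t $ t
      + (2 * (cos (real n * x $ t) * partial t G x)) * (real n * Q $ t $ t))"
    using bounded_family_trig[OF trig_poly.const[of "{}" "2"]]
    by (intro negligible_add negligible_mult negligible_first negligible_second negligible_second'
        bounded_family_mult c s bounded_family_trig[OF trig_poly_partial[OF G]]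
        bounded_family_trig[OF trig_poly_partial[OF trig_poly_partial[OF G]]])
next
  fix n x l and Q :: "real^'a^'a"
  have C: "trig_poly {t} (\<lambda>x. cos (real n * x $ t))" and S: "trig_poly {t} (\<lambda>x. sin (real n * x $ t))"
    by (auto intro: trig_poly_multiple_angle)
  have S2: "partial t (partial t (\<lambda>x. sin (real n * x $ t))) x = - ((real n)\<^sup>2 * sin (real n * x $ t))"
    unfolding partial_sin_multiple partial_trig_cmult[OF C] partial_cos_multiple
    by (simp add: power2_eq_square)
  show "diffop l Q (\<lambda>x. G x * sin (real n * x $ t)) x - G x * lead_sin t n x l Q =
      (sin (real n * x $ t) * partial t G x) * l $ t
      + (sin (real n * x $ t) * partial t (partial t G) x) * Q $ t $ t
      + (2 * (cos (real n * x $ t) * partial t G x)) * (real n * Q $ t $ t)"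
    unfolding diffop_outer[OF trig_poly.mult[OF G S]] partial2_trig_mult[OF G S] S2
    unfolding partial_trig_mult[OF G S] partial_sin_multiple lead_sin_def
    by (simp add: algebra_simps)
qed

text \<open>A slowly varying factor \<open>W\<close> passes through the operator like a constant.\<close>
lemma fast_slow_asymptotics:
  assumes F: "trig_poly S F" and W: "trig_poly S W" and t: "t \<notin> S"
  shows "negligible t (\<lambda>n x l Q. diffop l Q (\<lambda>x. F (real n *\<^sub>R x) * W x) x -
    W x * diffop (real n *\<^sub>R cut_vec t l) ((real n)\<^sup>2 *\<^sub>R cut_mat t Q) F (real n *\<^sub>R x))"
proof (rule negligible_cong)
  show "negligible t (\<lambda>n x l Q. F (real n *\<^sub>R x) * diffop (cut_vec t l) (cut_mat t Q) W x +
      2 * (real n * polar (cut_mat t Q) F (real n *\<^sub>R x) W x))"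
  proof (rule negligible_add)
    show "negligible t (\<lambda>n x l Q. F (real n *\<^sub>R x) * diffop (cut_vec t l) (cut_mat t Q) W x)"
      by (rule negligible_mult[OF bounded_family_trig[OF F] negligible_slow_diffop[OF W, of t "\<lambda>n x. x"]])
    show "negligible t (\<lambda>n x l Q. 2 * (real n * polar (cut_mat t Q) F (real n *\<^sub>R x) W x))"
      by (rule negligible_mult[OF bounded_family_trig[OF trig_poly.const[of "{}" 2]] negligible_slow_polar[OF F W]])
  qed
next
  fix n :: nat and x l and Q :: "real^'a^'a"
  assume Q: "\<And>i j. Q $ i $ j = Q $ j $ i"
  have sym: "\<And>i j. cut_mat t Q $ i $ j = cut_mat t Q $ j $ i" using Q by (auto simp: cut_mat_def)
  note Fn = trig_poly_dilate[OF F, of n]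
  show "diffop l Q (\<lambda>x. F (real n *\<^sub>R x) * W x) x -
      W x * diffop (real n *\<^sub>R cut_vec t l) ((real n)\<^sup>2 *\<^sub>R cut_mat t Q) F (real n *\<^sub>R x) =
      F (real n *\<^sub>R x) * diffop (cut_vec t l) (cut_mat t Q) W x +
      2 * (real n * polar (cut_mat t Q) F (real n *\<^sub>R x) W x)"
    unfolding diffop_inner[OF trig_poly.mult[OF Fn W] t, of l Q] diffop_mult[OF Fn W sym]
      diffop_dilate[OF F] polar_dilate[OF F] by simp
qed

text \<open>
  With the amplitude \<open>1/n\<close>, all derivatives of \<open>g(t) U(x)\<close> are negligible except the mixed ones, whose
  coefficients do not enter \<open>op_size\<close>.
\<close>
lemma small_amplitude_asymptotics:
  assumes U: "trig_poly S U" and g: "trig_poly {t} g" and t: "t \<notin> S"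
  shows "negligible t (\<lambda>n x l Q. diffop l Q (\<lambda>x. (1 / real n) * (g x * U x)) x -
    partial t g x * (\<Sum>i\<in>UNIV. ((2 / real n) *\<^sub>R cross t Q) $ i * partial i U x))"
proof (rule negligible_cong)
  have n: "bounded_family (\<lambda>n x. 1 / real n)"
    by (rule bounded_family_unit) auto
  show "negligible t (\<lambda>n x l Q. (1 / real n * (partial t g x * U x)) * l $ t +
      (1 / real n * (partial t (partial t g) x * U x)) * Q $ t $ t +
      (1 / real n * g x) * diffop (cut_vec t l) (cut_mat t Q) U x)"
  proof (intro negligible_add)
    show "negligible t (\<lambda>n x l Q. (1 / real n * g x) * diffop (cut_vec t l) (cut_mat t Q) U x)"
      by (rule negligible_mult[OF bounded_family_mult[OF n bounded_family_trig[OF g]]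
            negligible_slow_diffop[OF U, of t "\<lambda>n x. x"]])
  qed (intro negligible_mult negligible_first negligible_second' bounded_family_mult n
       bounded_family_trig[OF U] bounded_family_trig[OF trig_poly_partial[OF g]]
        bounded_family_trig[OF trig_poly_partial[OF trig_poly_partial[OF g]]])+
next
  fix n :: nat and x l and Q :: "real^'a^'a"
  assume Q: "\<And>i j. Q $ i $ j = Q $ j $ i"
  have m: "trig_poly (insert t S) (\<lambda>x. g x * U x)"
    by (intro trig_poly.mult trig_poly_mono[OF g] trig_poly_mono[OF U]) auto
  have sum: "(\<Sum>i\<in>UNIV. ((2 / real n) *\<^sub>R cross t Q) $ i * partial i U x) =
      2 / real n * (\<Sum>i\<in>UNIV. cross t Q $ i * partial i U x)"
    by (simp add: sum_distrib_left mult.assoc)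
  show "diffop l Q (\<lambda>x. (1 / real n) * (g x * U x)) x -
    partial t g x * (\<Sum>i\<in>UNIV. ((2 / real n) *\<^sub>R cross t Q) $ i * partial i U x) =
      (1 / real n * (partial t g x * U x)) * l $ t +
      (1 / real n * (partial t (partial t g) x * U x)) * Q $ t $ t +
      (1 / real n * g x) * diffop (cut_vec t l) (cut_mat t Q) U x"
    unfolding diffop_cmult[OF m] diffop_split_mult[OF U g t Q] sum
    by (simp add: algebra_simps)
qed

section \<open>A hypersurface torus\<close>

text \<open>
  The sequences \<open>u\<close> and \<open>\<nu>\<close> stand for maps into \<open>\<real>\<^bsup>k\<^esup>\<close> with \<open>k = card S + 1\<close>, padded by zeros. The
  last condition says that \<open>u\<close> is an immersion and \<open>\<nu>\<close> is transversal to it.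
\<close>
definition framed_torus :: "'m::finite set \<Rightarrow> (nat \<Rightarrow> real^'m \<Rightarrow> real) \<Rightarrow> (nat \<Rightarrow> real^'m \<Rightarrow> real) \<Rightarrow> bool" where
  "framed_torus S u \<nu> \<longleftrightarrow>
    (\<forall>j. trig_poly S (u j)) \<and> (\<forall>j. trig_poly S (\<nu> j)) \<and>
    (\<forall>j>card S. u j = (\<lambda>x. 0)) \<and> (\<forall>j>card S. \<nu> j = (\<lambda>x. 0)) \<and>
    (\<forall>x p c. (\<forall>j. p * \<nu> j x + (\<Sum>i\<in>S. c i * partial i (u j) x) = 0) \<longrightarrow> p = 0 \<and> (\<forall>i\<in>S. c i = 0))"

text \<open>
  The coordinate directions are principal directions of the hypersurface, with principal curvatures
  at most \<open>B\<close>.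
\<close>
definition curvature_le :: "real \<Rightarrow> 'm::finite set \<Rightarrow> (nat \<Rightarrow> real^'m \<Rightarrow> real) \<Rightarrow> (nat \<Rightarrow> real^'m \<Rightarrow> real) \<Rightarrow> bool" where
  "curvature_le B S u \<nu> \<longleftrightarrow>
    (\<forall>x. \<forall>i\<in>S. \<exists>\<mu>. \<bar>\<mu>\<bar> \<le> B \<and> (\<forall>j. partial i (\<nu> j) x = \<mu> * partial i (u j) x))"

text \<open>
  A circle bundle construction: the boundary of the tube of radius \<open>r\<close> around the hypersurface \<open>u\<close>,
  viewed in a space of one more dimension, is again a hypersurface, parametrized by
  \<open>(u + r cos t \<nu>, r sin t)\<close> with transversal field \<open>(cos t \<nu>, sin t)\<close>. It is immersed as long as \<open>r\<close> is
  smaller than the focal distance, for which it suffices to bound the curvatures along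
  the induction.
\<close>
lemma torus_hypersurface:
  fixes S :: "'m::finite set"
  shows "\<exists>u \<nu> B. framed_torus S u \<nu> \<and> B \<ge> 1 \<and> curvature_le B S u \<nu>"
proof (induction S rule: finite_induct[OF finite])
  case 1
  have "framed_torus ({} :: 'm set) (\<lambda>j x. 0) (\<lambda>j x. if j = 0 then 1 else 0)"
    unfolding framed_torus_def
  proof (intro conjI allI impI)
    fix x :: "real^'m" and p :: real and c :: "'m \<Rightarrow> real"
    assume "\<forall>j. p * (if j = (0::nat) then 1 else 0) + (\<Sum>i\<in>{}. c i * partial i (\<lambda>x. 0) x) = 0"
    from spec[OF this, of 0] show "p = 0" by simp
  qed (auto intro: trig_poly.const)
  moreover have "curvature_le 1 ({} :: 'm set) (\<lambda>j x. 0) (\<lambda>j x. if j = 0 then 1 else 0)"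
    by (simp add: curvature_le_def)
  ultimately show ?case by (meson order_refl)
next
  case (2 t S)
  let ?k = "Suc (card S)"
  obtain u \<nu> :: "nat \<Rightarrow> real^'m \<Rightarrow> real" and B where
    frame: "framed_torus S u \<nu>" and B: "B \<ge> 1" and curv: "curvature_le B S u \<nu>"
    using 2(3) by blast
  have u: "trig_poly S (u j)" and \<nu>: "trig_poly S (\<nu> j)" for j
    using frame by (simp_all add: framed_torus_def)
  have z: "u j = (\<lambda>x. 0)" "\<nu> j = (\<lambda>x. 0)" if "j > card S" for j
    using frame that by (simp_all add: framed_torus_def)
  have ind: "p = 0 \<and> (\<forall>i\<in>S. c i = 0)" if "\<And>j. p * \<nu> j x + (\<Sum>i\<in>S. c i * partial i (u j) x) = 0" for x p c
    using frame that unfolding framed_torus_def by presburger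
  have curv': "\<exists>\<mu>. \<bar>\<mu>\<bar> \<le> B \<and> (\<forall>j. partial i (\<nu> j) x = \<mu> * partial i (u j) x)" if "i \<in> S" for i x
    using curv that by (simp add: curvature_le_def)
  \<comment> \<open>The focal distance is at least \<open>1 / B\<close>; the new circle direction then has curvature exactly \<open>2 B\<close>.\<close>
  define r where "r = 1 / (2 * B)"
  have r: "r > 0" using B by (simp add: r_def)
  define \<delta> :: "nat \<Rightarrow> real" where "\<delta> j = (if j = ?k then 1 else 0)" for j
  define \<nu>' where "\<nu>' j = (\<lambda>x. cos (x $ t) * \<nu> j x + \<delta> j * sin (x $ t))" for j
  define u' where "u' j = (\<lambda>x. u j x + r * \<nu>' j x)" for j
  let ?T = "insert t S"
  have ct: "trig_poly ?T (\<lambda>x. cos (x $ t))" and st: "trig_poly ?T (\<lambda>x. sin (x $ t))"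
    by (auto intro: trig_poly.intros)
  have uT: "trig_poly ?T (u j)" and \<nu>T: "trig_poly ?T (\<nu> j)" for j
    by (rule trig_poly_mono[OF u] trig_poly_mono[OF \<nu>], blast)+
  have \<nu>'T: "trig_poly ?T (\<nu>' j)" for j
    unfolding \<nu>'_def by (intro trig_poly.add trig_poly.mult ct st \<nu>T trig_poly.const)
  have u'T: "trig_poly ?T (u' j)" for j
    unfolding u'_def by (intro trig_poly.add trig_poly.mult uT \<nu>'T trig_poly.const)
  have p\<nu>': "partial i (\<nu>' j) x = cos (x $ t) * partial i (\<nu> j) x +
      (if i = t then \<delta> j * cos (x $ t) - sin (x $ t) * \<nu> j x else 0)" for i j x
    unfolding \<nu>'_def
    by (subst partial_trig_add[OF trig_poly.mult[OF ct \<nu>T] trig_poly.mult[OF trig_poly.const st]])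
      (auto simp: partial_trig_mult[OF ct \<nu>] partial_trig_cmult[OF st] partial_cos_coord partial_sin_coord)
  have pu': "partial i (u' j) x = partial i (u j) x + r * partial i (\<nu>' j) x" for i j x
    unfolding u'_def
    by (subst partial_trig_add[OF u trig_poly.mult[OF trig_poly.const \<nu>'T]])
      (simp add: partial_trig_cmult[OF \<nu>'T])
  have t0: "partial t (u j) x = 0" "partial t (\<nu> j) x = 0" for j x
    using partial_trig_outside[OF u 2(2)] partial_trig_outside[OF \<nu> 2(2)] by simp_all
  have stretch: "1 + r * cos (x $ t) * \<mu> \<ge> 1 / 2" if "\<bar>\<mu>\<bar> \<le> B" for \<mu> and x :: "real^'m"
  proof -
    have "\<bar>cos (x $ t) * \<mu>\<bar> \<le> 1 * B"
      unfolding abs_mult using that by (intro mult_mono) auto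
    then have "\<bar>r * (cos (x $ t) * \<mu>)\<bar> \<le> r * B"
      unfolding abs_mult[of r] using r by (auto intro: mult_left_mono)
    also have "r * B = 1 / 2" using B by (simp add: r_def)
    finally show ?thesis by (simp add: mult.assoc)
  qed
  have "curvature_le (2 * B) ?T u' \<nu>'"
    unfolding curvature_le_def
  proof (intro allI ballI)
    fix x :: "real^'m" and i assume i: "i \<in> ?T"
    show "\<exists>\<mu>. \<bar>\<mu>\<bar> \<le> 2 * B \<and> (\<forall>j. partial i (\<nu>' j) x = \<mu> * partial i (u' j) x)"
    proof (cases "i = t")
      case True
      then show ?thesis
        using B by (intro exI[of _ "2 * B"]) (auto simp: pu' t0 r_def)
    next
      case False
      with i have "i \<in> S" by simp
      then obtain \<mu> where \<mu>: "\<bar>\<mu>\<bar> \<le> B" "\<And>j. partial i (\<nu> j) x = \<mu> * partial i (u j) x"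
        using curv' by blast
      let ?d = "1 + r * cos (x $ t) * \<mu>"
      have d: "?d \<ge> 1 / 2" by (rule stretch[OF \<mu>(1)])
      have "\<bar>cos (x $ t) * \<mu>\<bar> \<le> 1 * B"
        unfolding abs_mult using \<mu>(1) by (intro mult_mono) auto
      also have "\<dots> \<le> 2 * B * ?d" using d B by (simp add: mult_left_mono[of "1/2" ?d "2 * B"])
      finally have "\<bar>cos (x $ t) * \<mu> / ?d\<bar> \<le> 2 * B"
        using d by (simp add: abs_div field_simps)
      moreover have "partial i (\<nu>' j) x = cos (x $ t) * \<mu> / ?d * partial i (u' j) x" for j
      proof -
        have "partial i (u' j) x = ?d * partial i (u j) x"
          using False by (simp add: pu' p\<nu>' \<mu>(2) algebra_simps)
        then show ?thesis using False d by (simp add: p\<nu>' \<mu>(2))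
      qed
      ultimately show ?thesis by blast
    qed
  qed
  moreover have "framed_torus ?T u' \<nu>'"
    unfolding framed_torus_def
  proof (intro conjI allI impI)
    fix j
    show "trig_poly ?T (u' j)" "trig_poly ?T (\<nu>' j)" by (fact u'T, fact \<nu>'T)
    assume "card ?T < j"
    then have "j > card S" "\<delta> j = 0" using 2(1,2) by (auto simp: \<delta>_def)
    then show "u' j = (\<lambda>x. 0)" "\<nu>' j = (\<lambda>x. 0)" by (simp_all add: u'_def \<nu>'_def z)
  next
    fix x :: "real^'m" and p and c :: "'m \<Rightarrow> real"
    assume eq: "\<forall>j. p * \<nu>' j x + (\<Sum>i\<in>?T. c i * partial i (u' j) x) = 0"
    obtain \<mu> where \<mu>: "\<And>i. i \<in> S \<Longrightarrow> \<bar>\<mu> i\<bar> \<le> B"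
      "\<And>i j. i \<in> S \<Longrightarrow> partial i (\<nu> j) x = \<mu> i * partial i (u j) x"
      using curv'[of _ x] by metis
    let ?C = "cos (x $ t)" and ?S = "sin (x $ t)"
    let ?d = "\<lambda>i. 1 + r * ?C * \<mu> i"
    have pS: "partial i (u' j) x = ?d i * partial i (u j) x" if "i \<in> S" for i j
      using that 2(2) by (auto simp: pu' p\<nu>' \<mu>(2) algebra_simps)
    have eq': "(p * ?C - c t * r * ?S) * \<nu> j x + (\<Sum>i\<in>S. (c i * ?d i) * partial i (u j) x)
        + \<delta> j * (p * ?S + c t * r * ?C) = 0" for j
    proof -
      define X where "X = (\<Sum>i\<in>S. (c i * ?d i) * partial i (u j) x)"
      have "(\<Sum>i\<in>S. c i * partial i (u' j) x) = X"
        unfolding X_def by (intro sum.cong) (auto simp: pS)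
      moreover have "partial t (u' j) x = r * (\<delta> j * ?C - ?S * \<nu> j x)"
        by (simp add: pu' p\<nu>' t0)
      ultimately have "p * (?C * \<nu> j x + \<delta> j * ?S) + (c t * (r * (\<delta> j * ?C - ?S * \<nu> j x)) + X) = 0"
        using eq[rule_format, of j] 2(1,2) by (simp add: \<nu>'_def)
      then show ?thesis
        unfolding X_def[symmetric] by (simp add: algebra_simps)
    qed
    have last: "p * ?S + c t * r * ?C = 0"
      using eq'[of ?k] z[of ?k] by (simp add: \<delta>_def)
    have "p * ?C - c t * r * ?S = 0 \<and> (\<forall>i\<in>S. c i * ?d i = 0)"
      by (rule ind[of _ x]) (use eq' last in simp)
    then have first: "p * ?C - c t * r * ?S = 0" and cS: "\<And>i. i \<in> S \<Longrightarrow> c i * ?d i = 0" by auto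
    \<comment> \<open>The left-hand sides of \<open>first\<close> and \<open>last\<close> arise from \<open>(p, c t * r)\<close> by a rotation.\<close>
    have 1: "?C\<^sup>2 + ?S\<^sup>2 = 1" by simp
    have "p * (?C\<^sup>2 + ?S\<^sup>2) = (p * ?C - c t * r * ?S) * ?C + (p * ?S + c t * r * ?C) * ?S"
      by algebra
    then show "p = 0" unfolding 1 by (simp add: first last)
    have "c t * r * (?C\<^sup>2 + ?S\<^sup>2) = (p * ?S + c t * r * ?C) * ?C - (p * ?C - c t * r * ?S) * ?S"
      by algebra
    then have "c t = 0" unfolding 1 using r by (simp add: first last)
    moreover have "c i = 0" if "i \<in> S" for i
      using cS[OF that] stretch[OF \<mu>(1)[OF that], of x] by auto
    ultimately show "\<forall>i\<in>?T. c i = 0" by auto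
  qed
  moreover have "2 * B \<ge> 1" using B by simp
  ultimately show ?case by blast
qed

section \<open>A loop of injections with vanishing mean\<close>

text \<open>
  On sequences seen as coefficients of polynomials this is multiplication by \<open>X\<close>. The value \<open>z\<close> is the
  zero element, which is a number or a function.
\<close>
fun shift :: "'a \<Rightarrow> (nat \<Rightarrow> 'a) \<Rightarrow> nat \<Rightarrow> 'a" where
  "shift z w 0 = z"
| "shift z w (Suc j) = w j"

text \<open>
  Multiplication by \<open>C + S X\<close> is injective on polynomials, and its image consists of the homogeneous
  forms of degree \<open>k\<close> vanishing at the point \<open>(- C, S)\<close> of the projective line. Evaluation there is the scalar
  product with the vector of entries \<open>(- C)\<^sup>j S\<^bsup>k-j\<^esup>\<close>, so this vector itself lies
  outside the image.
\<close>
lemma rotating_shift_injective: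
  fixes w :: "nat \<Rightarrow> real" and C S q :: real
  assumes CS: "C\<^sup>2 + S\<^sup>2 = 1" and w: "w k = 0"
    and eq: "\<And>j. j \<le> k \<Longrightarrow> q * ((- C) ^ j * S ^ (k - j)) + (C * w j + S * shift 0 w j) = 0"
  shows "q = 0" "\<And>j. j < k \<Longrightarrow> w j = 0"
proof -
  define e where "e j = (- C) ^ j * S ^ (k - j)" for j
  \<comment> \<open>Orthogonality to the image: the sum telescopes since \<open>e (Suc j) * S = - C * e j\<close>.\<close>
  have tel: "(\<Sum>j\<le>n. e j * (C * w j + S * shift 0 w j)) = C * e n * w n" if "n \<le> k" for n
    using that
  proof (induction n)
    case (Suc n)
    have "e (Suc n) * S = - C * e n"
      using Suc.prems by (simp add: e_def Suc_diff_Suc flip: power_Suc2)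
    then have "e (Suc n) * (S * w n) = - C * e n * w n" by (metis mult.assoc)
    with Suc show ?case by (simp add: algebra_simps)
  qed simp
  have "0 = (\<Sum>j\<le>k. e j * (q * e j + (C * w j + S * shift 0 w j)))"
    using eq by (simp add: e_def)
  also have "\<dots> = q * (\<Sum>j\<le>k. (e j)\<^sup>2) + (\<Sum>j\<le>k. e j * (C * w j + S * shift 0 w j))"
    by (simp add: sum.distrib sum_distrib_left algebra_simps power2_eq_square)
  also have "\<dots> = q * (\<Sum>j\<le>k. (e j)\<^sup>2)"
    using tel[of k] w by simp
  finally have "q * (\<Sum>j\<le>k. (e j)\<^sup>2) = 0" by simp
  moreover have "(\<Sum>j\<le>k. (e j)\<^sup>2) \<noteq> 0"
  proof
    assume "(\<Sum>j\<le>k. (e j)\<^sup>2) = 0"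
    then have "\<forall>j\<le>k. e j = 0" by (simp add: sum_nonneg_eq_0_iff)
    then have "e 0 = 0" "e k = 0" by auto
    then show False using CS by (auto simp: e_def)
  qed
  ultimately show q: "q = 0" by simp
  show "w j = 0" if "j < k" for j
  proof (cases "C = 0")
    case True
    then have "S \<noteq> 0" using CS by auto
    with eq[of "Suc j"] that True q show ?thesis by auto
  next
    case False
    show ?thesis using that
    proof (induction j)
      case 0
      with eq[of 0] q False show ?case by auto
    next
      case (Suc j)
      with eq[of "Suc j"] q False show ?case by auto
    qed
  qed
qed

text \<open>
  The complementary direction \<open>e(t)\<close>. It passes from one end of the sequence of coordinates to the other
  as \<open>t\<close> moves from \<open>\<pi>/2\<close> to \<open>0\<close>.
\<close>
definition corner :: "'m \<Rightarrow> nat \<Rightarrow> nat \<Rightarrow> real^'m::finite \<Rightarrow> real" where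
  "corner t k j x = (- cos (x $ t)) ^ j * sin (x $ t) ^ (k - j)"

lemma corner_trig: "trig_poly {t} (corner t k j)"
  unfolding corner_def
  by (intro trig_poly.mult trig_poly_power trig_poly_minus trig_poly.intros) auto

lemma trig_poly_shift:
  fixes w :: "nat \<Rightarrow> real^'m::finite \<Rightarrow> real"
  assumes "\<And>j. trig_poly S (w j)"
  shows "trig_poly S (shift (\<lambda>_. 0) w j)"
proof (cases j)
  case 0
  then have "shift (\<lambda>_. 0) w j = (\<lambda>x. 0)" by (simp add: fun_eq_iff)
  then show ?thesis by (simp add: trig_poly.const)
qed (simp add: assms)

text \<open>
  The immersed torus is carried around by the loop of injections \<open>A(t)\<close>: the vectors \<open>A(t) \<nu>\<close>,
  \<open>e(t)\<close> and \<open>A(t) \<partial>\<^sub>i u\<close> are uniformly independent.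
\<close>
lemma moving_frame:
  fixes t :: "'m::finite"
  assumes t: "t \<notin> S"
  shows "\<exists>u \<nu> :: nat \<Rightarrow> real^'m \<Rightarrow> real. (\<forall>j. trig_poly S (u j)) \<and> (\<forall>j. trig_poly S (\<nu> j)) \<and>
    (\<exists>c>0. \<forall>x p q d. (\<forall>i. i \<notin> S \<longrightarrow> d $ i = 0) \<longrightarrow>
      c * norm (p, q, d) \<le> (\<Sum>j\<le>Suc (card S). \<bar>p * (cos (x $ t) * \<nu> j x + sin (x $ t) * shift (\<lambda>_. 0) \<nu> j x) +
        q * corner t (Suc (card S)) j x +
        (\<Sum>i\<in>UNIV. d $ i * (cos (x $ t) * partial i (u j) x + sin (x $ t) * partial i (shift (\<lambda>_. 0) u j) x))\<bar>))"
proof -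
  let ?k = "Suc (card S)"
  obtain u \<nu> :: "nat \<Rightarrow> real^'m \<Rightarrow> real" where frame: "framed_torus S u \<nu>"
    using torus_hypersurface[of S] by blast
  have u: "trig_poly S (u j)" and \<nu>: "trig_poly S (\<nu> j)" for j
    using frame by (simp_all add: framed_torus_def)
  have z: "u j = (\<lambda>x. 0)" "\<nu> j = (\<lambda>x. 0)" if "j > card S" for j
    using frame that by (simp_all add: framed_torus_def)
  have ind: "p = 0 \<and> (\<forall>i\<in>S. c i = 0)" if "\<And>j. p * \<nu> j x + (\<Sum>i\<in>S. c i * partial i (u j) x) = 0" for x p c
    using frame that unfolding framed_torus_def by presburger
  define comp where "comp j x p q d = p * (cos (x $ t) * \<nu> j x + sin (x $ t) * shift (\<lambda>_. 0) \<nu> j x) +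
        q * corner t ?k j x +
        (\<Sum>i\<in>UNIV. d $ i * (cos (x $ t) * partial i (u j) x + sin (x $ t) * partial i (shift (\<lambda>_. 0) u j) x))"
    for j and x :: "real^'m" and p q and d :: "real^'m"
  define V where "V = {v :: real \<times> real \<times> (real^'m). \<forall>i. i \<notin> S \<longrightarrow> snd (snd v) $ i = 0}"
  define \<Phi> where "\<Phi> x v = (\<Sum>j\<le>?k. \<bar>comp j x (fst v) (fst (snd v)) (snd (snd v))\<bar>)" for x and v :: "real \<times> real \<times> (real^'m)"
  note trigs = u \<nu> trig_poly_shift[of S u, OF u] trig_poly_shift[of S \<nu>, OF \<nu>] corner_trig
    trig_poly_partial[OF u] trig_poly_partial[OF trig_poly_shift[of S u, OF u]]
  have "\<exists>c>0. \<forall>x. \<forall>v\<in>V. c * norm v \<le> \<Phi> x v"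
  proof (rule uniform_injectivity_torus)
    show "continuous_on UNIV (\<lambda>p. \<Phi> (fst p) (snd p))"
      unfolding \<Phi>_def comp_def
      by (intro continuous_intros trigs[THEN trig_poly_continuous_fst])
    show "\<Phi> x v = \<Phi> y v" if "torus_rel x y" for x y v
    proof -
      have "cos (x $ t) = cos (y $ t)" "sin (x $ t) = sin (y $ t)"
        using trig_poly_periodic[OF trig_poly.cos[of t "{t}"] that] trig_poly_periodic[OF trig_poly.sin[of t "{t}"] that]
        by auto
      moreover note trigs[THEN trig_poly_periodic, OF that]
      ultimately show ?thesis unfolding \<Phi>_def comp_def by simp
    qed
    show "\<Phi> x (s *\<^sub>R v) = \<bar>s\<bar> * \<Phi> x v" for x s v
    proof -
      have "comp j x (s * p) (s * q) (s *\<^sub>R d) = s * comp j x p q d" for j p q d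
        unfolding comp_def by (simp add: algebra_simps sum_distrib_left)
      then show ?thesis by (simp add: \<Phi>_def abs_mult sum_distrib_left del: sum.atMost_Suc)
    qed
    show "subspace V"
      unfolding V_def by (auto simp: subspace_def)
    show "\<Phi> x v > 0" if v: "v \<in> V" "v \<noteq> 0" for x v
    proof (rule ccontr)
      obtain p q d where pqd: "v = (p, q, d)" by (cases v) auto
      have d: "\<And>i. i \<notin> S \<Longrightarrow> d $ i = 0" using v(1) by (auto simp: V_def pqd)
      assume "\<not> \<Phi> x v > 0"
      moreover have "\<Phi> x v \<ge> 0" unfolding \<Phi>_def by (intro sum_nonneg) simp
      ultimately have "\<Phi> x v = 0" by simp
      then have c0: "comp j x p q d = 0" if "j \<le> ?k" for j
        using that by (simp add: \<Phi>_def pqd sum_nonneg_eq_0_iff del: sum.atMost_Suc)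
      define w where "w j = p * \<nu> j x + (\<Sum>i\<in>UNIV. d $ i * partial i (u j) x)" for j
      have sw: "shift 0 w j = p * shift (\<lambda>_. 0) \<nu> j x + (\<Sum>i\<in>UNIV. d $ i * partial i (shift (\<lambda>_. 0) u j) x)" for j
        by (cases j) (auto simp: w_def)
      have eq: "q * ((- cos (x $ t)) ^ j * sin (x $ t) ^ (?k - j)) + (cos (x $ t) * w j + sin (x $ t) * shift 0 w j) = 0"
        if "j \<le> ?k" for j
        using c0[OF that] unfolding sw w_def comp_def corner_def
        by (simp add: algebra_simps sum.distrib sum_distrib_left)
      have wk: "w j = 0" if "j \<ge> ?k" for j using that z[of j] by (simp add: w_def)
      have 1: "(cos (x $ t))\<^sup>2 + (sin (x $ t))\<^sup>2 = 1" by simp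
      have "q = 0" and "\<And>j. j < ?k \<Longrightarrow> w j = 0"
        using rotating_shift_injective[OF 1 wk[OF order_refl] eq] by auto
      with wk have w0: "w j = 0" for j by (cases "j < ?k") auto
      have "(\<Sum>i\<in>UNIV. d $ i * partial i (u j) x) = (\<Sum>i\<in>S. d $ i * partial i (u j) x)" for j
        using d by (intro sum.mono_neutral_right) auto
      with w0 have "p = 0 \<and> (\<forall>i\<in>S. d $ i = 0)"
        by (intro ind[of _ x]) (simp add: w_def)
      with d have "p = 0" "d = 0" by (auto simp: vec_eq_iff)
      with \<open>q = 0\<close> v(2) pqd show False by (simp add: zero_prod_def)
    qed
  qed
  then obtain c where "c > 0" "\<And>x v. v \<in> V \<Longrightarrow> c * norm v \<le> \<Phi> x v" by blast
  then have "c > 0" "\<And>x p q d. (\<forall>i. i \<notin> S \<longrightarrow> d $ i = 0) \<Longrightarrow> c * norm (p, q, d) \<le> (\<Sum>j\<le>?k. \<bar>comp j x p q d\<bar>)"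
    by (auto simp: V_def \<Phi>_def)
  then show ?thesis
    unfolding comp_def using u \<nu> by blast
qed

section \<open>Adding a circle factor\<close>

text \<open>
  Freeness in the coordinates of \<open>S\<close>, phrased by duality: speaking of the kernel avoids the
  determinant of the jet matrix.
\<close>
definition nondegenerate :: "'m::finite set \<Rightarrow> nat \<Rightarrow> (nat \<Rightarrow> real^'m \<Rightarrow> real) \<Rightarrow> bool" where
  "nondegenerate S q f \<longleftrightarrow> (\<forall>a<q. trig_poly S (f a)) \<and>
    (\<forall>x l Q. (l, Q) \<in> op_space S \<longrightarrow> (\<forall>a<q. diffop l Q (f a) x = 0) \<longrightarrow> l = 0 \<and> Q = 0)"

lemma subspace_op_space: "subspace (op_space S)"
  unfolding subspace_def op_space_def by (auto simp: mem_Times_iff)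

lemma nondegenerate_uniform:
  fixes f :: "nat \<Rightarrow> real^'m::finite \<Rightarrow> real"
  assumes "nondegenerate S q f"
  shows "\<exists>c>0. \<forall>x. \<forall>v\<in>op_space S. c * norm v \<le> (\<Sum>a<q. \<bar>diffop (fst v) (snd v) (f a) x\<bar>)"
proof (rule uniform_injectivity_torus[OF _ _ _ subspace_op_space])
  have f: "trig_poly S (f a)" if "a < q" for a
    using assms that by (simp add: nondegenerate_def)
  show "continuous_on UNIV (\<lambda>p. \<Sum>a<q. \<bar>diffop (fst (snd p)) (snd (snd p)) (f a) (fst p)\<bar>)"
  proof (intro continuous_on_sum continuous_on_rabs)
    fix a assume "a \<in> {..<q}"
    then have "trig_poly S (f a)" using f by simp
    note trigs = trig_poly_partial[OF this, THEN trig_poly_continuous_fst]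
      trig_poly_partial[OF trig_poly_partial[OF this], THEN trig_poly_continuous_fst]
    show "continuous_on UNIV (\<lambda>p. diffop (fst (snd p)) (snd (snd p)) (f a) (fst p))"
      unfolding diffop_def by (intro continuous_intros trigs)
  qed
next
  fix x y :: "real^'m" and v assume xy: "torus_rel x y"
  have "diffop (fst v) (snd v) (f a) x = diffop (fst v) (snd v) (f a) y" if "a < q" for a
  proof -
    have "trig_poly S (f a)" using assms that by (simp add: nondegenerate_def)
    note trigs = trig_poly_partial[OF this, THEN trig_poly_periodic, OF xy]
      trig_poly_partial[OF trig_poly_partial[OF this], THEN trig_poly_periodic, OF xy]
    show ?thesis unfolding diffop_def by (simp add: trigs)
  qed
  then show "(\<Sum>a<q. \<bar>diffop (fst v) (snd v) (f a) x\<bar>) = (\<Sum>a<q. \<bar>diffop (fst v) (snd v) (f a) y\<bar>)"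
    by simp
next
  show "(\<Sum>a<q. \<bar>diffop (fst (s *\<^sub>R v)) (snd (s *\<^sub>R v)) (f a) x\<bar>) =
      \<bar>s\<bar> * (\<Sum>a<q. \<bar>diffop (fst v) (snd v) (f a) x\<bar>)" for x v s
    by (simp add: diffop_scale abs_mult sum_distrib_left)
next
  fix x :: "real^'m" and v assume v: "v \<in> op_space S" "v \<noteq> 0"
  have "(fst v, snd v) \<in> op_space S" "\<not> (fst v = 0 \<and> snd v = 0)"
    using v by (auto simp: prod_eq_iff)
  then obtain a where a: "a < q" "diffop (fst v) (snd v) (f a) x \<noteq> 0"
    using assms unfolding nondegenerate_def by blast
  then show "(\<Sum>a<q. \<bar>diffop (fst v) (snd v) (f a) x\<bar>) > 0"
    by (intro sum_pos2[of _ a]) auto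
qed

lemma nondegenerate_circle:
  "nondegenerate {t} 2 (\<lambda>a x. if a = 0 then cos (x $ t) else sin (x $ t))"
  unfolding nondegenerate_def
proof (intro conjI allI impI)
  show "trig_poly {t} (\<lambda>x. if a = 0 then cos (x $ t) else sin (x $ t))" for a :: nat
    by (cases "a = 0") (auto intro: trig_poly.intros)
next
  fix x l and Q :: "real^'a^'a"
  assume lQ: "(l, Q) \<in> op_space {t}"
    and eq: "\<forall>a<2. diffop l Q (\<lambda>x. if a = (0::nat) then cos (x $ t) else sin (x $ t)) x = 0"
  have c: "trig_poly {t} (\<lambda>x. cos (x $ t))" and s: "trig_poly {t} (\<lambda>x. sin (x $ t))"
    by (auto intro: trig_poly.intros)
  let ?c = "cos (x $ t)" and ?s = "sin (x $ t)"
  have 1: "- (l $ t * ?s) - Q $ t $ t * ?c = 0"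
    using eq[rule_format, of 0]
    by (simp add: diffop_outer[OF c] partial_cos_coord partial_trig_cmult[OF s, of _ "-1", simplified] partial_sin_coord)
  have 2: "l $ t * ?c - Q $ t $ t * ?s = 0"
    using eq[rule_format, of 1]
    by (simp add: diffop_outer[OF s] partial_cos_coord partial_sin_coord)
  have cs: "?c\<^sup>2 + ?s\<^sup>2 = 1" by simp
  have "l $ t * (?c\<^sup>2 + ?s\<^sup>2) = (l $ t * ?c - Q $ t $ t * ?s) * ?c - (- (l $ t * ?s) - Q $ t $ t * ?c) * ?s"
    by algebra
  then have lt: "l $ t = 0" unfolding cs 1 2 by simp
  have "Q $ t $ t * (?c\<^sup>2 + ?s\<^sup>2) = - (l $ t * ?c - Q $ t $ t * ?s) * ?s - (- (l $ t * ?s) - Q $ t $ t * ?c) * ?c"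
    by algebra
  then have Qt: "Q $ t $ t = 0" unfolding cs 1 2 by simp
  have "l $ i = 0" for i
    using lQ lt by (cases "i = t") (simp_all add: op_space_def)
  then show "l = 0" by (simp add: vec_eq_iff)
  have row: "Q $ i $ j = 0" if "i \<noteq> t" for i j
    using lQ that by (simp add: op_space_def)
  have "Q $ i $ j = Q $ j $ i" for i j
    using lQ by (simp add: op_space_def)
  then have "Q $ i $ j = 0" for i j
    using row Qt by (cases "i = t"; cases "j = t") metis+
  then show "Q = 0" by (simp add: vec_eq_iff)
qed

lemma negligibleE:
  assumes "negligible t E"
  obtains B where "B \<ge> 0" "\<And>n x l Q. n \<ge> 1 \<Longrightarrow> \<forall>i j. Q $ i $ j = Q $ j $ i \<Longrightarrow>
    \<bar>E n x l Q\<bar> \<le> B * op_size t n l Q / real n"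
  using assms unfolding negligible_def by metis

lemma negligible_abs: "negligible t E \<Longrightarrow> negligible t (\<lambda>n x l Q. \<bar>E n x l Q\<bar>)"
  unfolding negligible_def by simp

lemma negligible_sum:
  "(\<And>a. a \<in> A \<Longrightarrow> negligible t (E a)) \<Longrightarrow> negligible t (\<lambda>n x l Q. \<Sum>a\<in>A. E a n x l Q)"
  by (induction A rule: infinite_finite_induct) (auto intro: negligible_zero negligible_add)

lemma slow_coefficients_le_lead:
  fixes n :: nat
  shows "\<bar>real n * l $ t\<bar> + \<bar>(real n)\<^sup>2 * Q $ t $ t\<bar> \<le> 2 * (\<bar>lead_cos t n x l Q\<bar> + \<bar>lead_sin t n x l Q\<bar>)"
proof -
  let ?c = "cos (real n * x $ t)" and ?s = "sin (real n * x $ t)"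
  let ?P = "lead_cos t n x l Q" and ?R = "lead_sin t n x l Q"
  have cs: "?c\<^sup>2 + ?s\<^sup>2 = 1" by simp
  have b: "\<bar>a * cos y\<bar> \<le> \<bar>a\<bar>" "\<bar>a * sin y\<bar> \<le> \<bar>a\<bar>" for a y :: real
    by (auto simp: abs_mult intro: mult_right_le_one_le)
  have "real n * l $ t * (?c\<^sup>2 + ?s\<^sup>2) = ?R * ?c - ?P * ?s"
    unfolding lead_cos_def lead_sin_def by algebra
  moreover have "(real n)\<^sup>2 * Q $ t $ t * (?c\<^sup>2 + ?s\<^sup>2) = - (?P * ?c) - ?R * ?s"
    unfolding lead_cos_def lead_sin_def by algebra
  ultimately have "real n * l $ t = ?R * ?c - ?P * ?s" "(real n)\<^sup>2 * Q $ t $ t = - (?P * ?c) - ?R * ?s"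
    unfolding cs by simp_all
  moreover have tri: "\<bar>v - w\<bar> \<le> V + W" if "\<bar>v\<bar> \<le> V" "\<bar>w\<bar> \<le> W" for v w V W :: real
    using that by linarith
  have "\<bar>?R * ?c - ?P * ?s\<bar> \<le> \<bar>?R\<bar> + \<bar>?P\<bar>" by (rule tri[OF b(1) b(2)])
  moreover have "\<bar>- (?P * ?c) - ?R * ?s\<bar> \<le> \<bar>?P\<bar> + \<bar>?R\<bar>"
    by (rule tri[OF _ b(2)]) (simp only: abs_minus_cancel b(1))
  ultimately show ?thesis by simp
qed

lemma lead_cos_le: "\<bar>lead_cos t n x l Q\<bar> \<le> \<bar>real n * l $ t\<bar> + \<bar>(real n)\<^sup>2 * Q $ t $ t\<bar>"
proof -
  have b: "\<bar>a * cos y\<bar> \<le> \<bar>a\<bar>" "\<bar>a * sin y\<bar> \<le> \<bar>a\<bar>" for a y :: real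
    by (auto simp: abs_mult intro: mult_right_le_one_le)
  show ?thesis
    unfolding lead_cos_def using b(2)[of "real n * l $ t" "real n * x $ t"]
      b(1)[of "(real n)\<^sup>2 * Q $ t $ t" "real n * x $ t"] by linarith
qed

text \<open>
  The family described at the beginning. Two components of \<open>f\<close> are used, whence \<open>q \<ge> 2\<close>.
\<close>
lemma nondegenerate_insert:
  fixes f :: "nat \<Rightarrow> real^'m::finite \<Rightarrow> real"
  assumes nd: "nondegenerate S q f" and q: "q \<ge> 2" and t: "t \<notin> S"
  shows "\<exists>f'. nondegenerate (insert t S) (q + Suc (Suc (card S))) f'"
proof -
  let ?k = "Suc (card S)" and ?T = "insert t S"
  have f: "trig_poly S (f a)" if "a < q" for a
    using nd that by (simp add: nondegenerate_def)
  obtain u \<nu> :: "nat \<Rightarrow> real^'m \<Rightarrow> real" and c2 where "\<forall>j. trig_poly S (u j)" "\<forall>j. trig_poly S (\<nu> j)"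
    and c2: "c2 > 0" and frame: "\<forall>x p q d. (\<forall>i. i \<notin> S \<longrightarrow> d $ i = 0) \<longrightarrow>
      c2 * norm (p, q, d) \<le> (\<Sum>j\<le>?k. \<bar>p * (cos (x $ t) * \<nu> j x + sin (x $ t) * shift (\<lambda>_. 0) \<nu> j x) +
        q * corner t ?k j x +
        (\<Sum>i\<in>UNIV. d $ i * (cos (x $ t) * partial i (u j) x + sin (x $ t) * partial i (shift (\<lambda>_. 0) u j) x))\<bar>)"
    using moving_frame[OF t] by (elim exE conjE) (rule that, assumption+)
  then have u: "trig_poly S (u j)" and \<nu>: "trig_poly S (\<nu> j)" for j by simp_all
  obtain c1 where c1: "c1 > 0" "\<And>x v. v \<in> op_space S \<Longrightarrow>
      c1 * norm v \<le> (\<Sum>a<q. \<bar>diffop (fst v) (snd v) (f a) x\<bar>)"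
    using nondegenerate_uniform[OF nd] by blast
  define u' where "u' = shift (\<lambda>_. 0) u"
  define \<nu>' where "\<nu>' = shift (\<lambda>_. 0) \<nu>"
  have u': "trig_poly S (u' j)" and \<nu>': "trig_poly S (\<nu>' j)" for j
    unfolding u'_def \<nu>'_def by (rule trig_poly_shift, fact u, rule trig_poly_shift, fact \<nu>)
  define g where "g a = (if a = 0 then (\<lambda>x. cos (x $ t)) else if a = 1 then (\<lambda>x. sin (x $ t)) else (\<lambda>x::real^'m. 0))" for a :: nat
  have g: "trig_poly {t} (g a)" for a
    by (auto simp: g_def intro: trig_poly.intros)
  have ct: "trig_poly {t} (\<lambda>x. cos (x $ t))" and st: "trig_poly {t} (\<lambda>x. sin (x $ t))"
    by (auto intro: trig_poly.intros)
  define F where "F n a = (\<lambda>x. f a (real n *\<^sub>R x) + g a x * cos (real n * x $ t))" for n a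
  define b0 where "b0 n j = (\<lambda>x. f 0 (real n *\<^sub>R x) * \<nu> j x)" for n j
  define b1 where "b1 n j = (\<lambda>x. f 1 (real n *\<^sub>R x) * \<nu>' j x)" for n j
  define s0 where "s0 n j = (\<lambda>x. (1 / real n) * (sin (x $ t) * u j x))" for n j
  define s1 where "s1 n j = (\<lambda>x. (1 / real n) * ((-1) * cos (x $ t) * u' j x))" for n j
  define e where "e n j = (\<lambda>x. corner t ?k j x * sin (real n * x $ t))" for n j
  define H where "H n j = (\<lambda>x. (-1) * b0 n j x + ((-1) * b1 n j x + (s0 n j x + (s1 n j x + e n j x))))" for n j
  let ?D = "\<lambda>n l Q. diffop (real n *\<^sub>R cut_vec t l) ((real n)\<^sup>2 *\<^sub>R cut_mat t Q)"
  define fr where "fr j n x l Q = lead_cos t n x l Q * (cos (x $ t) * \<nu> j x + sin (x $ t) * \<nu>' j x) +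
        lead_sin t n x l Q * corner t ?k j x +
        (\<Sum>i\<in>UNIV. ((2 / real n) *\<^sub>R cross t Q) $ i *
          (cos (x $ t) * partial i (u j) x + sin (x $ t) * partial i (u' j) x))" for j n x l Q
  have mono: "trig_poly S G \<Longrightarrow> trig_poly ?T G" "trig_poly {t} G \<Longrightarrow> trig_poly ?T G" for G
    by (erule trig_poly_mono, blast)+
  have tf: "trig_poly {t} (\<lambda>x. cos (real n * x $ t))" "trig_poly {t} (\<lambda>x. sin (real n * x $ t))" for n
    by (auto intro: trig_poly_multiple_angle)
  have mct: "trig_poly {t} (\<lambda>x. (-1) * cos (x $ t))"
    by (intro trig_poly.mult trig_poly.const ct)
  have q01: "0 < q" "1 < q" using q by auto
  have b0T: "trig_poly ?T (b0 n j)" for n j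
    unfolding b0_def by (intro trig_poly.mult mono(1) trig_poly_dilate[OF f] q01 \<nu>)
  have b1T: "trig_poly ?T (b1 n j)" for n j
    unfolding b1_def by (intro trig_poly.mult mono(1) trig_poly_dilate[OF f] q01 \<nu>')
  have s0T: "trig_poly ?T (s0 n j)" for n j
    unfolding s0_def by (intro trig_poly.mult trig_poly.const mono(1)[OF u] mono(2)[OF st])
  have s1T: "trig_poly ?T (s1 n j)" for n j
    unfolding s1_def by (intro trig_poly.mult trig_poly.const mono(1)[OF u'] mono(2)[OF ct])
  have eT: "trig_poly ?T (e n j)" for n j
    unfolding e_def by (intro trig_poly.mult mono(2) corner_trig tf)
  note seT = trig_poly.add[OF s0T trig_poly.add[OF s1T eT]]
  note minus_b0T = trig_poly.mult[OF trig_poly.const b0T] and minus_b1T = trig_poly.mult[OF trig_poly.const b1T]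
  have FT: "trig_poly ?T (F n a)" if "a < q" for n a
    unfolding F_def by (intro trig_poly.add trig_poly.mult mono(1)[OF trig_poly_dilate[OF f]] mono(2)[OF g] mono(2)[OF tf(1)] that)
  have HT: "trig_poly ?T (H n j)" for n j
    unfolding H_def by (intro trig_poly.add trig_poly.mult trig_poly.const b0T b1T s0T s1T eT)

  have dF: "diffop l Q (F n a) x = ?D n l Q (f a) (real n *\<^sub>R x) + diffop l Q (\<lambda>x. g a x * cos (real n * x $ t)) x"
    if "a < q" for n a l Q x
    unfolding F_def
    by (subst diffop_add[OF trig_poly_dilate[OF f[OF that]] trig_poly.mult[OF g tf(1)]])
      (simp only: trans[OF diffop_inner[OF trig_poly_dilate[OF f[OF that]] t] diffop_dilate[OF f[OF that]]])
  have nF: "negligible t (\<lambda>n x l Q. diffop l Q (F n a) x - ?D n l Q (f a) (real n *\<^sub>R x) - g a x * lead_cos t n x l Q)"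
    if "a < q" for a
    by (rule negligible_cong[OF fast_cos_asymptotics[OF g[of a]]]) (simp only: dF[OF that] add_diff_cancel_left')

  have dH: "diffop l Q (H n j) x = (-1) * diffop l Q (b0 n j) x + ((-1) * diffop l Q (b1 n j) x +
      (diffop l Q (s0 n j) x + (diffop l Q (s1 n j) x + diffop l Q (e n j) x)))" for l Q n j x
    unfolding H_def
    by (simp only: diffop_add[OF minus_b0T trig_poly.add[OF minus_b1T seT]] diffop_add[OF minus_b1T seT]
        diffop_add[OF s0T trig_poly.add[OF s1T eT]] diffop_add[OF s1T eT] diffop_cmult[OF b0T] diffop_cmult[OF b1T])
  \<comment> \<open>The functions \<open>sin t\<close> and \<open>- cos t\<close> in \<open>s0\<close>, \<open>s1\<close> are primitives of the entries of \<open>A(t)\<close>.\<close>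
  have pst: "partial t (\<lambda>x. sin (x $ t)) = (\<lambda>x::real^'m. cos (x $ t))"
    by (simp add: partial_sin_coord)
  have pct: "partial t (\<lambda>x. (-1) * cos (x $ t)) = (\<lambda>x::real^'m. sin (x $ t))"
    by (simp only: partial_trig_cmult[OF ct]) (simp add: partial_cos_coord)
  have nb0: "negligible t (\<lambda>n x l Q. diffop l Q (b0 n j) x - \<nu> j x * ?D n l Q (f 0) (real n *\<^sub>R x))" for j
    unfolding b0_def by (rule fast_slow_asymptotics[OF f[OF q01(1)] \<nu> t])
  have nb1: "negligible t (\<lambda>n x l Q. diffop l Q (b1 n j) x - \<nu>' j x * ?D n l Q (f 1) (real n *\<^sub>R x))" for j
    unfolding b1_def by (rule fast_slow_asymptotics[OF f[OF q01(2)] \<nu>' t])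
  have ns0: "negligible t (\<lambda>n x l Q. diffop l Q (s0 n j) x -
      cos (x $ t) * (\<Sum>i\<in>UNIV. ((2 / real n) *\<^sub>R cross t Q) $ i * partial i (u j) x))" for j
    using small_amplitude_asymptotics[OF u st t, of j] unfolding s0_def pst .
  have ns1: "negligible t (\<lambda>n x l Q. diffop l Q (s1 n j) x -
      sin (x $ t) * (\<Sum>i\<in>UNIV. ((2 / real n) *\<^sub>R cross t Q) $ i * partial i (u' j) x))" for j
    using small_amplitude_asymptotics[OF u' mct t, of j] unfolding s1_def pct .
  have ne: "negligible t (\<lambda>n x l Q. diffop l Q (e n j) x - corner t ?k j x * lead_sin t n x l Q)" for j
    unfolding e_def by (rule fast_sin_asymptotics[OF corner_trig])
  have nF0: "negligible t (\<lambda>n x l Q. \<nu> j x * (diffop l Q (F n 0) x - ?D n l Q (f 0) (real n *\<^sub>R x) - g 0 x * lead_cos t n x l Q))" for j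
    by (rule negligible_mult[OF bounded_family_trig[OF \<nu>, where y = "\<lambda>n x. x"] nF[OF q01(1)]])
  have nF1: "negligible t (\<lambda>n x l Q. \<nu>' j x * (diffop l Q (F n 1) x - ?D n l Q (f 1) (real n *\<^sub>R x) - g 1 x * lead_cos t n x l Q))" for j
    by (rule negligible_mult[OF bounded_family_trig[OF \<nu>', where y = "\<lambda>n x. x"] nF[OF q01(2)]])
  \<comment> \<open>Adding multiples of the first components eliminates the rescaled slow operator from \<open>H\<close>, and
    what remains is the frame \<open>fr\<close>.\<close>
  have nH: "negligible t (\<lambda>n x l Q. diffop l Q (H n j) x + \<nu> j x * diffop l Q (F n 0) x + \<nu>' j x * diffop l Q (F n 1) x - fr j n x l Q)" for j
  proof (rule negligible_cong)
    show "negligible t (\<lambda>n x l Q.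
      - (diffop l Q (b0 n j) x - \<nu> j x * ?D n l Q (f 0) (real n *\<^sub>R x))
      - (diffop l Q (b1 n j) x - \<nu>' j x * ?D n l Q (f 1) (real n *\<^sub>R x))
      + (diffop l Q (s0 n j) x -
          cos (x $ t) * (\<Sum>i\<in>UNIV. ((2 / real n) *\<^sub>R cross t Q) $ i * partial i (u j) x))
      + (diffop l Q (s1 n j) x -
          sin (x $ t) * (\<Sum>i\<in>UNIV. ((2 / real n) *\<^sub>R cross t Q) $ i * partial i (u' j) x))
      + (diffop l Q (e n j) x - corner t ?k j x * lead_sin t n x l Q)
      + \<nu> j x * (diffop l Q (F n 0) x - ?D n l Q (f 0) (real n *\<^sub>R x) - g 0 x * lead_cos t n x l Q)
      + \<nu>' j x * (diffop l Q (F n 1) x - ?D n l Q (f 1) (real n *\<^sub>R x) - g 1 x * lead_cos t n x l Q))"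
      by (intro negligible_add negligible_diff negligible_minus nb0 nb1 ns0 ns1 ne nF0 nF1)
  next
    fix n :: nat and x l and Q :: "real^'m^'m"
    define A where "A w = (\<Sum>i\<in>UNIV. ((2 / real n) *\<^sub>R cross t Q) $ i * partial i w x)" for w
    have "(\<Sum>i\<in>UNIV. ((2 / real n) *\<^sub>R cross t Q) $ i *
          (cos (x $ t) * partial i (u j) x + sin (x $ t) * partial i (u' j) x)) = cos (x $ t) * A (u j) + sin (x $ t) * A (u' j)"
      unfolding A_def by (simp add: algebra_simps sum.distrib sum_distrib_left)
    then show "diffop l Q (H n j) x + \<nu> j x * diffop l Q (F n 0) x + \<nu>' j x * diffop l Q (F n 1) x - fr j n x l Q =
      - (diffop l Q (b0 n j) x - \<nu> j x * ?D n l Q (f 0) (real n *\<^sub>R x))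
      - (diffop l Q (b1 n j) x - \<nu>' j x * ?D n l Q (f 1) (real n *\<^sub>R x))
      + (diffop l Q (s0 n j) x -
          cos (x $ t) * (\<Sum>i\<in>UNIV. ((2 / real n) *\<^sub>R cross t Q) $ i * partial i (u j) x))
      + (diffop l Q (s1 n j) x -
          sin (x $ t) * (\<Sum>i\<in>UNIV. ((2 / real n) *\<^sub>R cross t Q) $ i * partial i (u' j) x))
      + (diffop l Q (e n j) x - corner t ?k j x * lead_sin t n x l Q)
      + \<nu> j x * (diffop l Q (F n 0) x - ?D n l Q (f 0) (real n *\<^sub>R x) - g 0 x * lead_cos t n x l Q)
      + \<nu>' j x * (diffop l Q (F n 1) x - ?D n l Q (f 1) (real n *\<^sub>R x) - g 1 x * lead_cos t n x l Q)"
      unfolding dH fr_def A_def[symmetric]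
      by (simp add: g_def algebra_simps)
  qed

  have nF_sum: "negligible t (\<lambda>n x l Q. \<Sum>a<q.
      \<bar>diffop l Q (F n a) x - ?D n l Q (f a) (real n *\<^sub>R x) - g a x * lead_cos t n x l Q\<bar>)"
    by (intro negligible_sum negligible_abs nF) simp
  have nH_sum: "negligible t (\<lambda>n x l Q. \<Sum>j\<le>?k.
      \<bar>diffop l Q (H n j) x + \<nu> j x * diffop l Q (F n 0) x + \<nu>' j x * diffop l Q (F n 1) x - fr j n x l Q\<bar>)"
    by (intro negligible_sum negligible_abs nH)
  obtain B1 where B1: "B1 \<ge> 0" "\<And>n x l Q. n \<ge> 1 \<Longrightarrow> \<forall>i j. Q $ i $ j = Q $ j $ i \<Longrightarrow>
      \<bar>\<Sum>a<q. \<bar>diffop l Q (F n a) x - ?D n l Q (f a) (real n *\<^sub>R x) - g a x * lead_cos t n x l Q\<bar>\<bar> \<le> B1 * op_size t n l Q / real n"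
    using nF_sum by (rule negligibleE) (rule that)
  obtain B2 where B2: "B2 \<ge> 0" "\<And>n x l Q. n \<ge> 1 \<Longrightarrow> \<forall>i j. Q $ i $ j = Q $ j $ i \<Longrightarrow>
      \<bar>\<Sum>j\<le>?k. \<bar>diffop l Q (H n j) x + \<nu> j x * diffop l Q (F n 0) x + \<nu>' j x * diffop l Q (F n 1) x - fr j n x l Q\<bar>\<bar>
        \<le> B2 * op_size t n l Q / real n"
    using nH_sum by (rule negligibleE) (rule that)
  \<comment> \<open>With \<open>N\<close>, \<open>M\<close> the two summands of \<open>op_size\<close>, the old components will give \<open>N \<le> C3 M\<close> by absorbing half of \<open>c1 N\<close>;
    the choice of \<open>n\<close> makes this possible and lets the frame absorb the errors in \<open>H\<close>.\<close>
  define C3 where "C3 = 4 / c1 + 1"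
  have C3: "C3 > 0" using c1(1) by (simp add: C3_def add_pos_pos)
  obtain n :: nat where n: "real n \<ge> 1 + 2 * B1 / c1 + 8 * B2 * (C3 + 1) / c2"
    using real_arch_simple by blast
  have nn: "2 * B1 / c1 \<ge> 0" "8 * B2 * (C3 + 1) / c2 \<ge> 0" using B1(1) B2(1) c1(1) c2 C3 by auto
  have n1: "n \<ge> 1" using n nn by linarith
  have nB1: "B1 / real n \<le> c1 / 2"
  proof -
    have "2 * B1 / c1 \<le> real n" using n nn by linarith
    then show ?thesis using c1(1) n1 by (simp add: field_simps)
  qed
  have nB2: "4 * B2 * (C3 + 1) / real n \<le> c2 / 2"
  proof -
    have "8 * B2 * (C3 + 1) / c2 \<le> real n" using n nn by linarith
    then show ?thesis using c2 n1 by (simp add: field_simps)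
  qed
  define f' where "f' a = (if a < q then F n a else H n (a - q))" for a
  have "nondegenerate ?T (q + Suc (Suc (card S))) f'"
    unfolding nondegenerate_def
  proof (intro conjI allI impI)
    show "trig_poly ?T (f' a)" for a
      using FT HT by (simp add: f'_def)
  next
    fix x l and Q :: "real^'m^'m"
    assume lQ: "(l, Q) \<in> op_space ?T" and z: "\<forall>a<q + Suc (Suc (card S)). diffop l Q (f' a) x = 0"
    have sym: "\<forall>i j. Q $ i $ j = Q $ j $ i" using lQ by (simp add: op_space_def)
    have zF: "diffop l Q (F n a) x = 0" if "a < q" for a
      using z[rule_format, of a] that by (simp add: f'_def)
    have zH: "diffop l Q (H n j) x = 0" if "j \<le> ?k" for j
      using z[rule_format, of "q + j"] that by (simp add: f'_def)
    define P where "P = lead_cos t n x l Q"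
    define R where "R = lead_sin t n x l Q"
    define d where "d = (2 / real n) *\<^sub>R cross t Q"
    define M where "M = \<bar>real n * l $ t\<bar> + \<bar>(real n)\<^sup>2 * Q $ t $ t\<bar>"
    define N where "N = norm (real n *\<^sub>R cut_vec t l, (real n)\<^sup>2 *\<^sub>R cut_mat t Q)"
    have size: "op_size t n l Q = N + M" by (simp add: op_size_def N_def M_def)
    have M0: "M \<ge> 0" "N \<ge> 0" by (simp_all add: M_def N_def)
    have PM: "\<bar>P\<bar> \<le> M" unfolding P_def M_def by (rule lead_cos_le)
    have "\<bar>P\<bar> \<le> norm (P, R, d)" using norm_fst_le[of P "(R, d)"] by simp
    moreover have "\<bar>R\<bar> \<le> norm (P, R, d)"
      using norm_snd_le[of "(R, d)" P] norm_fst_le[of R d] by simp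
    ultimately have MX: "M \<le> 4 * norm (P, R, d)"
      using slow_coefficients_le_lead[of n l t Q x] by (simp add: M_def P_def R_def)
    have "(real n *\<^sub>R cut_vec t l, (real n)\<^sup>2 *\<^sub>R cut_mat t Q) \<in> op_space S"
      using cut_op_space[OF lQ] by (auto simp: op_space_def)
    from c1(2)[OF this, of "real n *\<^sub>R x"]
    have "c1 * N \<le> (\<Sum>a<q. \<bar>?D n l Q (f a) (real n *\<^sub>R x)\<bar>)" by (simp add: N_def)
    also have "\<dots> \<le> (\<Sum>a<q. \<bar>diffop l Q (F n a) x - ?D n l Q (f a) (real n *\<^sub>R x) - g a x * P\<bar> + \<bar>g a x\<bar> * \<bar>P\<bar>)"
      using zF by (intro sum_mono) (auto simp: abs_mult[symmetric])
    also have "\<dots> = (\<Sum>a<q. \<bar>diffop l Q (F n a) x - ?D n l Q (f a) (real n *\<^sub>R x) - g a x * P\<bar>) + (\<Sum>a<q. \<bar>g a x\<bar>) * \<bar>P\<bar>"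
      by (simp add: sum.distrib sum_distrib_right)
    also have "\<dots> \<le> B1 * (N + M) / real n + 2 * M"
    proof (rule add_mono)
      show "(\<Sum>a<q. \<bar>diffop l Q (F n a) x - ?D n l Q (f a) (real n *\<^sub>R x) - g a x * P\<bar>) \<le> B1 * (N + M) / real n"
        using B1(2)[OF n1 sym, of l x] unfolding size P_def by simp
      have "(\<Sum>a<q. \<bar>g a x\<bar>) = (\<Sum>a\<in>{0, 1}. \<bar>g a x\<bar>)"
        using q01 by (intro sum.mono_neutral_right) (auto simp: g_def)
      also have "\<dots> \<le> 2" by (simp add: g_def) (metis abs_cos_le_one abs_sin_le_one add_mono one_add_one)
      finally show "(\<Sum>a<q. \<bar>g a x\<bar>) * \<bar>P\<bar> \<le> 2 * M"
        using PM by (intro mult_mono) auto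
    qed
    also have "B1 * (N + M) / real n \<le> c1 / 2 * (N + M)"
      using mult_right_mono[OF nB1, of "N + M"] M0 by simp
    finally have "c1 * N \<le> c1 / 2 * (N + M) + 2 * M" by simp
    then have "c1 * N \<le> 4 * M + c1 * M"
      by (simp add: field_simps)
    also have "\<dots> = c1 * (C3 * M)"
      using c1(1) by (simp add: C3_def field_simps)
    finally have "c1 * N \<le> c1 * (C3 * M)" .
    then have NM: "N \<le> C3 * M" using c1(1) by simp
    have "c2 * norm (P, R, d) \<le> (\<Sum>j\<le>?k. \<bar>fr j n x l Q\<bar>)"
      unfolding P_def R_def d_def fr_def u'_def \<nu>'_def
    proof (rule frame[rule_format])
      fix i assume "i \<notin> S"
      then show "((2 / real n) *\<^sub>R cross t Q) $ i = 0"
        using lQ by (auto simp: cross_def op_space_def)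
    qed
    also have "\<dots> = (\<Sum>j\<le>?k. \<bar>diffop l Q (H n j) x + \<nu> j x * diffop l Q (F n 0) x + \<nu>' j x * diffop l Q (F n 1) x - fr j n x l Q\<bar>)"
      using zF[OF q01(1)] zF[OF q01(2)] zH by (intro sum.cong) auto
    also have "\<dots> \<le> B2 * (N + M) / real n"
      using B2(2)[OF n1 sym, of l x] unfolding size by simp
    also have "\<dots> \<le> B2 * ((C3 + 1) * (4 * norm (P, R, d))) / real n"
    proof (intro divide_right_mono mult_left_mono B2(1))
      have "N + M \<le> (C3 + 1) * M" using NM by (simp add: algebra_simps)
      also have "\<dots> \<le> (C3 + 1) * (4 * norm (P, R, d))" using MX C3 by (intro mult_left_mono) auto
      finally show "N + M \<le> (C3 + 1) * (4 * norm (P, R, d))" .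
    qed simp
    also have "\<dots> = 4 * B2 * (C3 + 1) / real n * norm (P, R, d)" by simp
    also have "\<dots> \<le> c2 / 2 * norm (P, R, d)" by (intro mult_right_mono nB2) simp
    finally have "c2 * norm (P, R, d) \<le> 0" by simp
    then have X: "norm (P, R, d) = 0" using c2 by (simp add: mult_le_0_iff)
    then have "M = 0" and d0: "d = 0" using MX M0 by (auto simp: prod_eq_iff)
    then have "\<bar>real n * l $ t\<bar> = 0 \<and> \<bar>(real n)\<^sup>2 * Q $ t $ t\<bar> = 0"
      unfolding M_def by (subst (asm) add_nonneg_eq_0_iff) simp_all
    then have lt: "l $ t = 0" "Q $ t $ t = 0" using n1 by simp_all
    have "N = 0" using NM M0 \<open>M = 0\<close> by simp
    then have cut: "cut_vec t l = 0" "cut_mat t Q = 0" using n1 by (auto simp: N_def prod_eq_iff)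
    have cr: "cross t Q = 0" using d0 n1 by (simp add: d_def)
    have "l $ i = 0" for i
      using cut(1) lt(1) by (cases "i = t") (auto simp: cut_vec_def vec_eq_iff split: if_splits)
    then show "l = 0" by (simp add: vec_eq_iff)
    have Qt: "Q $ i $ t = 0" for i
      using cr lt(2) by (cases "i = t") (auto simp: cross_def vec_eq_iff split: if_splits)
    have "Q $ i $ j = 0" for i j
    proof (cases "i = t \<or> j = t")
      case True
      then show ?thesis using Qt[of i] Qt[of j] sym by metis
    next
      case False
      have "cut_mat t Q $ i $ j = 0" using cut(2) by simp
      with False show ?thesis by (simp add: cut_mat_def)
    qed
    then show "Q = 0" by (simp add: vec_eq_iff)
  qed
  then show ?thesis by blast
qed

lemma q_dim_Suc: "q_dim (Suc n) = q_dim n + Suc (Suc n)"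
proof -
  have "Suc n * (Suc n + 3) = n * (n + 3) + 2 * Suc (Suc n)" by (simp add: algebra_simps)
  then show ?thesis by (simp add: q_dim_def)
qed

lemma exists_nondegenerate:
  fixes S :: "'m::finite set"
  assumes "S \<noteq> {}"
  shows "\<exists>f. nondegenerate S (q_dim (card S)) f"
  using finite[of S] assms
proof (induction S rule: finite_ne_induct)
  case (singleton t)
  have "q_dim (card {t}) = 2" by (simp add: q_dim_def)
  show ?case unfolding \<open>q_dim (card {t}) = 2\<close> by (rule exI, rule nondegenerate_circle)
next
  case (insert t S)
  then obtain f where f: "nondegenerate S (q_dim (card S)) f" by blast
  have "card S \<ge> 1" using insert by (simp add: Suc_leI card_gt_0_iff)
  then have "q_dim (card S) \<ge> 2"
    by (cases "card S") (auto simp: q_dim_Suc)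
  from nondegenerate_insert[OF f this] insert show ?case
    by (simp add: q_dim_Suc)
qed

section \<open>Free maps from nondegenerate families\<close>

lemma has_derivative_vec_lambda:
  fixes f :: "'q::finite \<Rightarrow> 'a::real_normed_vector \<Rightarrow> real"
  assumes "\<And>a. (f a has_derivative f' a) (at x)"
  shows "((\<lambda>x. \<chi> a. f a x) has_derivative (\<lambda>h. \<chi> a. f' a h)) (at x)"
  by (subst has_derivative_componentwise_within) (auto simp: Basis_vec_def inner_axis assms)

lemma partial_vec_lambda:
  assumes "\<And>a. trig_poly S (f a)"
  shows "partial \<alpha> (\<lambda>x. \<chi> a::'q::finite. f a x) = (\<lambda>x. \<chi> a. partial \<alpha> (f a) x)"
proof
  fix x
  have "((\<lambda>x. \<chi> a. f a x) has_derivative (\<lambda>h. \<chi> a. frechet_derivative (f a) (at x) h)) (at x)"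
    using trig_poly_differentiable[OF assms] by (intro has_derivative_vec_lambda) (simp add: frechet_derivative_works)
  from partial_eqI[OF this] show "partial \<alpha> (\<lambda>x. \<chi> a. f a x) x = (\<chi> a. partial \<alpha> (f a) x)"
    by (simp add: partial_def)
qed

lemma C_times_vec_lambda:
  fixes f :: "'q::finite \<Rightarrow> real^'m::finite \<Rightarrow> real"
  assumes "\<And>a. trig_poly S (f a)"
  shows "C_times k (\<lambda>x. \<chi> a. f a x)"
  using assms
proof (induction k arbitrary: f)
  case 0
  then show ?case by (auto intro!: continuous_on_vec_lambda trig_poly_continuous)
next
  case (Suc k)
  have "(\<lambda>x. \<chi> a. f a x) differentiable (at x)" for x
    unfolding differentiable_def
    using has_derivative_vec_lambda[of f "\<lambda>a. frechet_derivative (f a) (at x)" x]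
      trig_poly_differentiable[OF Suc.prems, of _ x] unfolding frechet_derivative_works by blast
  moreover have "C_times k (partial \<alpha> (\<lambda>x. \<chi> a. f a x))" for \<alpha>
    unfolding partial_vec_lambda[OF Suc.prems] by (rule Suc.IH) (rule trig_poly_partial[OF Suc.prems])
  ultimately show ?case by simp
qed

text \<open>
  Linear independence of an indexed family, in the form of injectivity together with independence of
  its range.
\<close>
lemma independent_family:
  fixes v :: "'i \<Rightarrow> 'b::real_vector"
  assumes fin: "finite J"
    and zero: "\<And>c s. (\<Sum>s\<in>J. c s *\<^sub>R v s) = 0 \<Longrightarrow> s \<in> J \<Longrightarrow> c s = 0"
  shows "inj_on v J \<and> independent (v ` J)"
proof
  show inj: "inj_on v J"
  proof (rule inj_onI, rule ccontr)
    fix r s assume rs: "r \<in> J" "s \<in> J" "v r = v s" "r \<noteq> s"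
    define c :: "'i \<Rightarrow> real" where "c = (\<lambda>i. (if i = r then 1 else 0) - (if i = s then 1 else 0))"
    have d: "(\<Sum>i\<in>J. (if i = j then 1 else 0) *\<^sub>R v i) = v j" if "j \<in> J" for j
      using that fin by (simp add: if_distrib[of "\<lambda>c. c *\<^sub>R _"] sum.delta cong: if_cong)
    have "(\<Sum>i\<in>J. c i *\<^sub>R v i) = v r - v s"
      unfolding c_def scaleR_diff_left sum_subtractf using d rs by simp
    then have "c r = 0" using zero rs by simp
    then show False using rs by (simp add: c_def)
  qed
  show "independent (v ` J)"
  proof (rule independent_if_scalars_zero)
    fix g y assume "(\<Sum>y\<in>v ` J. g y *\<^sub>R y) = 0" "y \<in> v ` J"
    then show "g y = 0"
      using zero[of "\<lambda>s. g (v s)"] by (auto simp: sum.reindex[OF inj])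
  qed (use fin in simp)
qed

text \<open>
  The symmetric matrix whose quadratic form has the coefficients \<open>c (i, j)\<close> for \<open>i \<le> j\<close>.
\<close>
definition sym_part :: "('m \<times> 'm \<Rightarrow> real) \<Rightarrow> real^'m::{finite,linorder}^'m::{finite,linorder}" where
  "sym_part c = (\<chi> i j. ((if i \<le> j then c (i, j) else 0) + (if j \<le> i then c (j, i) else 0)) / 2)"

lemma sum_jet_index:
  fixes G :: "('m::{finite,linorder}) + 'm \<times> 'm \<Rightarrow> 'b::comm_monoid_add"
  shows "(\<Sum>s\<in>jet_index. G s) = (\<Sum>i\<in>UNIV. G (Inl i)) + (\<Sum>i\<in>UNIV. \<Sum>j\<in>UNIV. if i \<le> j then G (Inr (i, j)) else 0)"
proof -
  have "(\<Sum>s\<in>jet_index. G s) = (\<Sum>s\<in>range Inl. G s) + (\<Sum>s\<in>Inr ` {(\<alpha>, \<beta>). \<alpha> \<le> \<beta>}. G s)"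
    unfolding jet_index_def by (rule sum.union_disjoint) auto
  also have "(\<Sum>s\<in>range Inl. G s) = (\<Sum>i\<in>UNIV. G (Inl i))"
    by (simp add: sum.reindex)
  also have "(\<Sum>s\<in>Inr ` {(\<alpha>, \<beta>). \<alpha> \<le> \<beta>}. G s) = (\<Sum>p\<in>{(\<alpha>, \<beta>). \<alpha> \<le> \<beta>}. G (Inr p))"
    by (subst sum.reindex) auto
  also have "\<dots> = (\<Sum>p\<in>UNIV \<times> UNIV. if fst p \<le> snd p then G (Inr p) else 0)"
    by (rule sum.mono_neutral_cong_left) auto
  also have "\<dots> = (\<Sum>i\<in>UNIV. \<Sum>j\<in>UNIV. if i \<le> j then G (Inr (i, j)) else 0)"
    unfolding sum.cartesian_product by (intro sum.cong) auto
  finally show ?thesis .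
qed

lemma diffop_sym_part:
  fixes f :: "real^'m::{finite,linorder} \<Rightarrow> real"
  assumes "trig_poly S f"
  shows "diffop (\<chi> i. c (Inl i)) (sym_part (\<lambda>p. c (Inr p))) f x = (\<Sum>s\<in>jet_index. c s * jet f x s)"
proof -
  let ?U = "\<lambda>i j. if i \<le> j then c (Inr (i, j)) else 0"
  let ?h = "\<lambda>i j. partial i (partial j f) x"
  have "(\<Sum>i\<in>UNIV. \<Sum>j\<in>UNIV. ?U j i * ?h i j) = (\<Sum>i\<in>UNIV. \<Sum>j\<in>UNIV. ?U i j * ?h i j)"
    by (subst sum.swap) (simp add: partial_commute[OF assms])
  moreover have "(\<Sum>i\<in>UNIV. \<Sum>j\<in>UNIV. sym_part (\<lambda>p. c (Inr p)) $ i $ j * ?h i j) =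
      ((\<Sum>i\<in>UNIV. \<Sum>j\<in>UNIV. ?U i j * ?h i j) + (\<Sum>i\<in>UNIV. \<Sum>j\<in>UNIV. ?U j i * ?h i j)) / 2"
    unfolding sum.distrib[symmetric] sum_divide_distrib
    by (intro sum.cong refl) (simp add: sym_part_def field_simps)
  ultimately have "(\<Sum>i\<in>UNIV. \<Sum>j\<in>UNIV. sym_part (\<lambda>p. c (Inr p)) $ i $ j * ?h i j) =
      (\<Sum>i\<in>UNIV. \<Sum>j\<in>UNIV. ?U i j * ?h i j)" by simp
  also have "\<dots> = (\<Sum>i\<in>UNIV. \<Sum>j\<in>UNIV. if i \<le> j then c (Inr (i, j)) * ?h i j else 0)"
    by (intro sum.cong refl) simp
  finally show ?thesis
    by (simp add: diffop_def sum_jet_index cong: if_cong)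
qed

lemma jet_vec_lambda:
  assumes "\<And>a. trig_poly S (f a)"
  shows "jet (\<lambda>x. \<chi> a::'q::finite. f a x) x s = (\<chi> a. jet (f a) x s)"
proof (cases s)
  case (Inl i)
  then show ?thesis by (simp add: partial_vec_lambda[OF assms])
next
  case (Inr p)
  then show ?thesis
    by (cases p) (simp add: partial_vec_lambda[OF assms] partial_vec_lambda[OF trig_poly_partial[OF assms]])
qed

text \<open>
  A linear relation among the jets is a second order operator that annihilates every component.
\<close>
lemma jets_independent:
  fixes f :: "'q::finite \<Rightarrow> real^'m::{finite,linorder} \<Rightarrow> real"
  assumes trig: "\<And>a. trig_poly UNIV (f a)"
    and nd: "\<And>l Q. (l, Q) \<in> op_space UNIV \<Longrightarrow> (\<And>a. diffop l Q (f a) x = 0) \<Longrightarrow> l = 0 \<and> Q = 0"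
  defines "F \<equiv> \<lambda>x. \<chi> a. f a x"
  shows "inj_on (jet F x) jet_index \<and> independent (jet F x ` jet_index)"
proof (rule independent_family)
  show "finite (jet_index :: ('m + 'm \<times> 'm) set)" by simp
next
  fix c and s :: "'m + 'm \<times> 'm" assume z: "(\<Sum>s\<in>jet_index. c s *\<^sub>R jet F x s) = 0" and s: "s \<in> jet_index"
  let ?l = "\<chi> i. c (Inl i)" and ?Q = "sym_part (\<lambda>p. c (Inr p))"
  have "?l = 0 \<and> ?Q = 0"
  proof (rule nd)
    show "(?l, ?Q) \<in> op_space UNIV"
      by (simp add: op_space_def sym_part_def add.commute)
    fix a
    have "(\<Sum>s\<in>jet_index. c s * jet (f a) x s) = (\<Sum>s\<in>jet_index. c s *\<^sub>R jet F x s) $ a"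
      by (simp add: F_def jet_vec_lambda[OF trig])
    then show "diffop ?l ?Q (f a) x = 0"
      by (simp add: diffop_sym_part[OF trig] z)
  qed
  then have l: "c (Inl i) = 0" and Q: "?Q $ i $ j = 0" for i j
    by (auto simp: vec_eq_iff)
  show "c s = 0"
  proof (cases s)
    case (Inl i)
    then show ?thesis using l by simp
  next
    case (Inr p)
    obtain i j where p: "p = (i, j)" by (cases p) auto
    with s Inr have "i \<le> j" by (auto simp: jet_index_def)
    with Q[of i j] show ?thesis
      by (cases "i = j") (auto simp: sym_part_def Inr p)
  qed
qed

theorem theorem1:
  assumes "CARD('q::finite) = q_dim CARD('m::{finite,linorder})"
  shows "(Free_smooth :: ('m torus \<Rightarrow> real^'q) set) \<noteq> {}"
proof -
  obtain f :: "nat \<Rightarrow> real^'m::{finite,linorder} \<Rightarrow> real" where f: "nondegenerate UNIV CARD('q) f"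
    using exists_nondegenerate[of "UNIV :: 'm set"] assms by auto
  obtain idx :: "'q \<Rightarrow> nat" where idx: "bij_betw idx UNIV {0..<CARD('q)}"
    using ex_bij_betw_finite_nat[of "UNIV :: 'q set"] by auto
  have idx_less: "idx a < CARD('q)" for a
    using idx by (auto simp: bij_betw_def)
  have trig: "trig_poly UNIV (f (idx a))" for a
    using f idx_less by (simp add: nondegenerate_def)
  define F where "F = (\<lambda>x. \<chi> a. f (idx a) x)"
  define \<phi> :: "'m torus \<Rightarrow> real^'q" where "\<phi> p = F (rep_torus p)" for p
  have lift: "torus_lift \<phi> = F"
  proof
    fix x :: "real^'m::{finite,linorder}"
    have "torus_rel (rep_torus (torus_proj x)) x"
      by (metis Quotient3_rep_abs Quotient3_torus equivp_reflp equivp_torus_rel)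
    from trig_poly_periodic[OF trig this] show "torus_lift \<phi> x = F x"
      by (simp add: torus_lift_def \<phi>_def F_def)
  qed
  have C: "torus_C k \<phi>" for k
    unfolding torus_C_def lift F_def by (rule C_times_vec_lambda[OF trig])
  have "inj_on (jet F x) jet_index \<and> independent (jet F x ` jet_index)" for x
    unfolding F_def
  proof (rule jets_independent[OF trig])
    fix l and Q :: "real^'m::{finite,linorder}^'m::{finite,linorder}"
    assume lQ: "(l, Q) \<in> op_space UNIV" and z: "\<And>a. diffop l Q (f (idx a)) x = 0"
    have "diffop l Q (f b) x = 0" if "b < CARD('q)" for b
    proof -
      have "b \<in> range idx" using idx that by (auto simp: bij_betw_def)
      then show ?thesis using z by auto
    qed
    with f lQ show "l = 0 \<and> Q = 0" unfolding nondegenerate_def by blast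
  qed
  then have "\<phi> \<in> Free_smooth"
    using C by (simp add: Free_smooth_def torus_smooth_def free_map_def lift)
  then show ?thesis by blast
qed

end
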